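(* Let $a,b\in\mathbb{R}^3$ be orthogonal nonzero vectors, let $S\in \mathrm{SO}(3)$ be the rotation about $a$ by $\pi/2$ and $T\in \mathrm{SO}(3)$ the rotation about $b$ by $\pi/3$, and let $$z=\tfrac18\left(S+ST^3+S^2T^3+T^4+T^4S^2+3\right)\in\mathbb{C}[\mathrm{SO}(3)].$$ Then the spectrum of the Quaquaversal operator is real. That is, the operator $\pi(z):L^2(\mathrm{SO}(3))\to L^2(\mathrm{SO}(3))$ has spectrum contained in $\mathbb{R}$, and for every integer $k\ge 0$ all eigenvalues of the operator $\pi_{2k+1}(z):H_{2k+1}\to H_{2k+1}$ are real.
   Context: $\mathbb{C}[\mathrm{SO}(3)]$ is the complex group ring of $\mathrm{SO}(3)$ (finite formal complex linear combinations of rotations); the "$3$" in $z$ denotes three times the identity rotation. $\pi$ denotes the (left) regular unitary representation of $\mathrm{SO}(3)$ on $L^2(\mathrm{SO}(3))$ (with respect to Haar measure), $(\pi(g)f)(x)=f(g^{-1}x)$. For each integer $k\ge 0$, $H_{2k+1}$ is the unique (up to isomorphism) irreducible unitary complex representation of $\mathrm{SO}(3)$ of dimension $2k+1$, and $\pi_{2k+1}$ denotes this action. Both $\pi$ and $\pi_{2k+1}$ are extended linearly to $\mathbb{C}[\mathrm{SO}(3)]$. By the Peter–Weyl theorem, $L^2(\mathrm{SO}(3))$ is the orthogonal Hilbert direct sum over $k$ of $2k+1$ copies of $H_{2k+1}$. *)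

theory Defs
  imports
    "HOL-Analysis.Analysis"
    "HOL-Library.Poly_Mapping"
    "HOL-Algebra.Group"
    "Jordan_Normal_Form.Schur_Decomposition"
begin

subsection \<open>The group SO(3)\<close>

definition SO3 :: "(real^3^3) monoid" where
  "SO3 = \<lparr>carrier = {A. rotation_matrix A}, monoid.mult = (**), one = Finite_Cartesian_Product.mat 1\<rparr>"

text \<open>Rodrigues' formula; the angle is counterclockwise with respect to the axis \<open>a\<close>
  (right-hand rule).\<close>

definition rotation_about :: "real^3 \<Rightarrow> real \<Rightarrow> real^3^3" where
  "rotation_about a \<theta> = matrix (\<lambda>x. let u = sgn a in
     cos \<theta> *\<^sub>R x + sin \<theta> *\<^sub>R cross3 u x + ((1 - cos \<theta>) * (u \<bullet> x)) *\<^sub>R u)"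

subsection \<open>The group ring\<close>

text \<open>The elements of the complex group ring of SO(3) are the finitely supported functions
  whose support (\<open>keys\<close>) lies in the carrier of SO(3); \<open>Poly_Mapping.single g c\<close> is the formal
  multiple \<open>c g\<close>.\<close>

definition quaquaversal :: "real^3^3 \<Rightarrow> real^3^3 \<Rightarrow> (real^3^3) \<Rightarrow>\<^sub>0 complex" where
  "quaquaversal S T = (let \<delta> = (\<lambda>g. Poly_Mapping.single g 1) in
     Poly_Mapping.map (\<lambda>c. 1/8 * c)
      (\<delta> S
       + \<delta> (S \<otimes>\<^bsub>SO3\<^esub> T [^]\<^bsub>SO3\<^esub> (3::nat))
       + \<delta> (S [^]\<^bsub>SO3\<^esub> (2::nat) \<otimes>\<^bsub>SO3\<^esub> T [^]\<^bsub>SO3\<^esub> (3::nat))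
       + \<delta> (T [^]\<^bsub>SO3\<^esub> (4::nat))
       + \<delta> (T [^]\<^bsub>SO3\<^esub> (4::nat) \<otimes>\<^bsub>SO3\<^esub> S [^]\<^bsub>SO3\<^esub> (2::nat))
       + Poly_Mapping.single \<one>\<^bsub>SO3\<^esub> 3))"

subsection \<open>The Hilbert space of square-integrable functions\<close>

definition L2_fun :: "'a measure \<Rightarrow> ('a \<Rightarrow> complex) set" where
  "L2_fun M = {f \<in> borel_measurable M. integrable M (\<lambda>x. (cmod (f x))\<^sup>2)}"

definition L2_rel :: "'a measure \<Rightarrow> (('a \<Rightarrow> complex) \<times> ('a \<Rightarrow> complex)) set" where
  "L2_rel M = {(f, g). f \<in> L2_fun M \<and> g \<in> L2_fun M \<and> (AE x in M. f x = g x)}"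

definition L2 :: "'a measure \<Rightarrow> ('a \<Rightarrow> complex) set set" where
  "L2 M = L2_fun M // L2_rel M"

definition L2_norm :: "'a measure \<Rightarrow> ('a \<Rightarrow> complex) set \<Rightarrow> real" where
  "L2_norm M X = sqrt (\<integral>x. (cmod ((SOME f. f \<in> X) x))\<^sup>2 \<partial>M)"

text \<open>The map on equivalence classes induced by a map \<open>A\<close> on functions that respects
  almost-everywhere equality.\<close>

definition L2_lift ::
  "'a measure \<Rightarrow> (('a \<Rightarrow> complex) \<Rightarrow> 'a \<Rightarrow> complex) \<Rightarrow> ('a \<Rightarrow> complex) set \<Rightarrow> ('a \<Rightarrow> complex) set" where
  "L2_lift M A X = (\<Union>f\<in>X. L2_rel M `` {A f})"

definition L2_resolvent_set ::
  "'a measure \<Rightarrow> (('a \<Rightarrow> complex) \<Rightarrow> 'a \<Rightarrow> complex) \<Rightarrow> complex set" where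
  "L2_resolvent_set M A = {c. let B = L2_lift M (\<lambda>f x. c * f x - A f x) in
     bij_betw B (L2 M) (L2 M) \<and> (\<exists>C. \<forall>X\<in>L2 M. L2_norm M X \<le> C * L2_norm M (B X))}"

definition L2_spectrum ::
  "'a measure \<Rightarrow> (('a \<Rightarrow> complex) \<Rightarrow> 'a \<Rightarrow> complex) \<Rightarrow> complex set" where
  "L2_spectrum M A = - L2_resolvent_set M A"

subsection \<open>The left regular representation\<close>

text \<open>A Haar measure on the compact metrizable group SO(3) is a nonzero finite left-invariant
  Borel measure; regularity is automatic.\<close>

definition haar_measure_SO3 :: "(real^3^3) measure \<Rightarrow> bool" where
  "haar_measure_SO3 M \<longleftrightarrow>
     sets M = sets (restrict_space borel (carrier SO3)) \<and>
     finite_measure M \<and> emeasure M (space M) \<noteq> 0 \<and>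
     (\<forall>g\<in>carrier SO3. distr M M (\<lambda>x. g \<otimes>\<^bsub>SO3\<^esub> x) = M)"

definition left_regular :: "real^3^3 \<Rightarrow> (real^3^3 \<Rightarrow> complex) \<Rightarrow> (real^3^3 \<Rightarrow> complex)" where
  "left_regular g f = (\<lambda>x. f (inv\<^bsub>SO3\<^esub> g \<otimes>\<^bsub>SO3\<^esub> x))"

definition left_regular_ext ::
  "((real^3^3) \<Rightarrow>\<^sub>0 complex) \<Rightarrow> (real^3^3 \<Rightarrow> complex) \<Rightarrow> (real^3^3 \<Rightarrow> complex)" where
  "left_regular_ext z f =
     (\<lambda>x. \<Sum>g\<in>Poly_Mapping.keys z. Poly_Mapping.lookup z g * left_regular g f x)"

subsection \<open>Finite-dimensional representations\<close>

text \<open>Unitary representations of dimension \<open>n\<close> are realised on \<open>n\<close>-dimensional complex column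
  vectors with the standard inner product. Continuity is stated entrywise.\<close>

definition unitary_rep_SO3 :: "nat \<Rightarrow> (real^3^3 \<Rightarrow> complex Matrix.mat) \<Rightarrow> bool" where
  "unitary_rep_SO3 n \<rho> \<longleftrightarrow>
     (\<forall>g\<in>carrier SO3. \<rho> g \<in> carrier_mat n n \<and> mat_adjoint (\<rho> g) * \<rho> g = 1\<^sub>m n) \<and>
     (\<forall>g\<in>carrier SO3. \<forall>h\<in>carrier SO3. \<rho> (g \<otimes>\<^bsub>SO3\<^esub> h) = \<rho> g * \<rho> h) \<and>
     (\<forall>i<n. \<forall>j<n. continuous_on (carrier SO3) (\<lambda>g. \<rho> g $$ (i, j)))"

definition invariant_subspace_SO3 ::
  "nat \<Rightarrow> (real^3^3 \<Rightarrow> complex Matrix.mat) \<Rightarrow> complex Matrix.vec set \<Rightarrow> bool" where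
  "invariant_subspace_SO3 n \<rho> W \<longleftrightarrow>
     W \<subseteq> carrier_vec n \<and> 0\<^sub>v n \<in> W \<and>
     (\<forall>v\<in>W. \<forall>w\<in>W. v + w \<in> W) \<and> (\<forall>c. \<forall>v\<in>W. c \<cdot>\<^sub>v v \<in> W) \<and>
     (\<forall>g\<in>carrier SO3. \<forall>v\<in>W. \<rho> g *\<^sub>v v \<in> W)"

definition irreducible_unitary_rep_SO3 :: "nat \<Rightarrow> (real^3^3 \<Rightarrow> complex Matrix.mat) \<Rightarrow> bool" where
  "irreducible_unitary_rep_SO3 n \<rho> \<longleftrightarrow>
     n > 0 \<and> unitary_rep_SO3 n \<rho> \<and>
     (\<forall>W. invariant_subspace_SO3 n \<rho> W \<longrightarrow> W = {0\<^sub>v n} \<or> W = carrier_vec n)"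

definition rep_ext ::
  "nat \<Rightarrow> (real^3^3 \<Rightarrow> complex Matrix.mat) \<Rightarrow> ((real^3^3) \<Rightarrow>\<^sub>0 complex) \<Rightarrow> complex Matrix.mat" where
  "rep_ext n \<rho> z = Matrix.mat n n
     (\<lambda>(i, j). \<Sum>g\<in>Poly_Mapping.keys z. Poly_Mapping.lookup z g * \<rho> g $$ (i, j))"

subsection \<open>Well-definedness\<close>

lemma SO3_simps [simp]:
  "carrier SO3 = {A. rotation_matrix A}" "A \<otimes>\<^bsub>SO3\<^esub> B = A ** B"
  "\<one>\<^bsub>SO3\<^esub> = Finite_Cartesian_Product.mat 1"
  by (simp_all add: SO3_def)

lemma group_SO3: "group SO3"
proof (rule groupI)
  fix A :: "real^3^3" assume "A \<in> carrier SO3"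
  then have "rotation_matrix (Finite_Cartesian_Product.transpose A)"
    "Finite_Cartesian_Product.transpose A ** A = Finite_Cartesian_Product.mat 1"
    by (auto simp: rotation_matrix_def orthogonal_matrix_transpose Determinants.det_transpose
        orthogonal_matrix_def)
  then show "\<exists>B\<in>carrier SO3. B \<otimes>\<^bsub>SO3\<^esub> A = \<one>\<^bsub>SO3\<^esub>" by auto
qed (auto simp: rotation_matrix_def orthogonal_matrix_mul orthogonal_matrix_id
      Determinants.det_mul matrix_mul_assoc)

lemma rotation_about_works:
  "rotation_about a \<theta> *v x =
     cos \<theta> *\<^sub>R x + sin \<theta> *\<^sub>R cross3 (sgn a) x + ((1 - cos \<theta>) * (sgn a \<bullet> x)) *\<^sub>R sgn a"
proof -
  have "linear (\<lambda>x. cos \<theta> *\<^sub>R x + sin \<theta> *\<^sub>R cross3 (sgn a) x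
      + ((1 - cos \<theta>) * (sgn a \<bullet> x)) *\<^sub>R sgn a)"
    by (rule linearI)
      (simp_all add: cross_add_right cross_mult_right inner_add_right algebra_simps)
  then show ?thesis
    unfolding rotation_about_def Let_def
    by (subst matrix_works) (simp_all add: linear_def scalar_mult_eq_scaleR)
qed

lemma rotation_about_in_SO3:
  assumes "a \<noteq> 0"
  shows "rotation_about a \<theta> \<in> carrier SO3"
proof -
  define u c s where "u = sgn a" and "c = cos \<theta>" and "s = sin \<theta>"
  define x y w where "x = u $ 1" and "y = u $ 2" and "w = u $ 3"
  let ?R = "rotation_about a \<theta>"
  have "u \<bullet> u = 1"
    using assms by (simp add: u_def norm_sgn flip: power2_norm_eq_inner)
  then have u1: "x * x + y * y + w * w = 1"
    by (simp add: inner_vec_def sum_3 x_def y_def w_def)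
  have cs: "c * c + s * s = 1"
    using sin_cos_squared_add[of \<theta>] by (simp add: c_def s_def power2_eq_square)
  have ent: "?R $ i $ j = (?R *v axis j 1) $ i" for i j
    by (simp add: matrix_vector_mult_basis column_def)
  have R: "?R $ i $ j = c * axis j 1 $ i + s * cross3 u (axis j 1) $ i
      + (1 - c) * (u $ j) * u $ i" for i j
    unfolding ent rotation_about_works
    by (simp add: u_def c_def s_def inner_axis)
  have e: "?R $ 1 $ 1 = c + (1 - c) * x * x" "?R $ 1 $ 2 = - s * w + (1 - c) * y * x"
    "?R $ 1 $ 3 = s * y + (1 - c) * w * x" "?R $ 2 $ 1 = s * w + (1 - c) * x * y"
    "?R $ 2 $ 2 = c + (1 - c) * y * y" "?R $ 2 $ 3 = - s * x + (1 - c) * w * y"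
    "?R $ 3 $ 1 = - s * y + (1 - c) * x * w" "?R $ 3 $ 2 = s * x + (1 - c) * y * w"
    "?R $ 3 $ 3 = c + (1 - c) * w * w"
    by (simp_all add: R axis_def cross3_def x_def y_def w_def)
  have "Determinants.det ?R = c^3 + c * s\<^sup>2 * n + (1 - c) * (c\<^sup>2 * n + s\<^sup>2 * n\<^sup>2)"
    if "n = x * x + y * y + w * w" for n
    unfolding Determinants.det_3 e that
    by (simp add: algebra_simps power2_eq_square power3_eq_cube)
  from this[OF u1[symmetric]] have "Determinants.det ?R = c * (c * c + s * s) + (1 - c) * (c * c + s * s)"
    by (simp add: algebra_simps power2_eq_square power3_eq_cube)
  then have "Determinants.det ?R = 1"
    by (simp add: cs)
  moreover have "orthogonal_transformation ((*v) ?R)"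
    unfolding orthogonal_transformation
  proof (intro conjI allI)
    fix v :: "real^3"
    have eq: "?R *v v = c *\<^sub>R v + s *\<^sub>R cross3 u v + ((1 - c) * (u \<bullet> v)) *\<^sub>R u"
      by (simp add: rotation_about_works u_def c_def s_def)
    have crs: "cross3 u v \<bullet> cross3 u v = v \<bullet> v - (u \<bullet> v)\<^sup>2"
      using norm_cross[of u v] \<open>u \<bullet> u = 1\<close> by (simp add: power2_norm_eq_inner)
    have "(?R *v v) \<bullet> (?R *v v) = (c * c + s * s) * (v \<bullet> v)
        + (1 - c * c - s * s) * (u \<bullet> v)\<^sup>2"
      unfolding eq using \<open>u \<bullet> u = 1\<close>
      by (simp add: inner_add_left inner_add_right dot_cross_self inner_commute[of v u] crs)
        (simp add: algebra_simps power2_eq_square)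
    also have "\<dots> = v \<bullet> v"
      using cs by (simp add: algebra_simps)
    finally show "norm (?R *v v) = norm v"
      by (simp add: norm_eq)
  qed simp
  ultimately show ?thesis
    by (simp add: rotation_matrix_def orthogonal_transformation_matrix)
qed

lemma keys_quaquaversal:
  assumes "S \<in> carrier SO3" "T \<in> carrier SO3"
  shows "Poly_Mapping.keys (quaquaversal S T) \<subseteq> carrier SO3"
proof -
  interpret group SO3 by (rule group_SO3)
  have map: "Poly_Mapping.keys (Poly_Mapping.map f p) \<subseteq> Poly_Mapping.keys p"
    for f :: "complex \<Rightarrow> complex" and p :: "(real^3^3) \<Rightarrow>\<^sub>0 complex"
    by (auto simp: in_keys_iff map.rep_eq when_def split: if_splits)
  have single: "Poly_Mapping.keys (Poly_Mapping.single g c) \<subseteq> carrier SO3"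
    if "g \<in> carrier SO3" for g and c :: complex
    using that by (cases "c = 0") simp_all
  have add: "Poly_Mapping.keys (p + q) \<subseteq> carrier SO3"
    if "Poly_Mapping.keys p \<subseteq> carrier SO3" "Poly_Mapping.keys q \<subseteq> carrier SO3"
    for p q :: "(real^3^3) \<Rightarrow>\<^sub>0 complex"
    using that keys_add[of p q] by blast
  show ?thesis
    unfolding quaquaversal_def Let_def
    by (rule order_trans[OF map], intro add single m_closed nat_pow_closed one_closed assms)
qed

lemma equiv_L2_rel: "equiv (L2_fun M) (L2_rel M)"
proof (rule equivI)
  show "trans (L2_rel M)"
    by (rule transI) (auto simp: L2_rel_def)
qed (auto simp: L2_rel_def refl_on_def sym_def)

lemma left_translation_measurable:
  assumes "haar_measure_SO3 M" "g \<in> carrier SO3"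
  shows "(\<lambda>x. g \<otimes>\<^bsub>SO3\<^esub> x) \<in> measurable M M"
proof -
  have sM: "sets M = sets (restrict_space borel (carrier SO3))"
    using assms(1) by (simp add: haar_measure_SO3_def)
  have "linear (\<lambda>x :: real^3^3. g ** x)"
    by (rule linearI)
      (simp_all add: matrix_add_ldistrib Finite_Cartesian_Product.vec_eq_iff
        matrix_matrix_mult_def sum_distrib_left algebra_simps)
  then have "(\<lambda>x :: real^3^3. g ** x) \<in> borel_measurable borel"
    by (intro borel_measurable_continuous_onI linear_continuous_on)
      (simp add: linear_conv_bounded_linear)
  then have "(\<lambda>x :: real^3^3. g ** x) \<in> measurable (restrict_space borel (carrier SO3))
      (restrict_space borel (carrier SO3))"
    using assms(2)
    by (intro measurable_restrict_space3)
      (auto simp: rotation_matrix_def orthogonal_matrix_mul Determinants.det_mul)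
  then show ?thesis
    by (simp add: measurable_cong_sets[OF sM sM])
qed

lemma left_regular_L2:
  assumes M: "haar_measure_SO3 M" and g: "g \<in> carrier SO3"
  shows "f \<in> L2_fun M \<Longrightarrow> left_regular g f \<in> L2_fun M"
    and "(f, h) \<in> L2_rel M \<Longrightarrow> (left_regular g f, left_regular g h) \<in> L2_rel M"
proof -
  let ?t = "\<lambda>x. inv\<^bsub>SO3\<^esub> g \<otimes>\<^bsub>SO3\<^esub> x"
  have i: "inv\<^bsub>SO3\<^esub> g \<in> carrier SO3"
    using g by (rule group.inv_closed[OF group_SO3])
  note t = left_translation_measurable[OF M i]
  have d: "distr M M ?t = M"
    using M i unfolding haar_measure_SO3_def by blast
  show *: "left_regular g f \<in> L2_fun M" if "f \<in> L2_fun M" for f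
  proof -
    have f: "f \<in> borel_measurable M" "integrable (distr M M ?t) (\<lambda>x. (cmod (f x))\<^sup>2)"
      using that by (simp_all only: d) (simp_all add: L2_fun_def)
    then show ?thesis
      using measurable_compose[OF t f(1)] integrable_distr[OF t f(2)]
      by (simp add: L2_fun_def left_regular_def)
  qed
  show "(left_regular g f, left_regular g h) \<in> L2_rel M" if "(f, h) \<in> L2_rel M"
  proof -
    have "AE x in distr M M ?t. f x = h x"
      using that by (simp only: d) (simp add: L2_rel_def)
    from AE_distrD[OF t this] show ?thesis
      using that * by (simp add: L2_rel_def left_regular_def)
  qed
qed

end

theory Submission
  imports Defs "HOL-Library.Function_Algebras"
begin

text \<open>Put \<open>s = S\<^sup>2\<close>, \<open>t = T\<^sup>3\<close>, \<open>r = T\<^sup>4\<close>. Then \<open>s\<close> and \<open>t\<close> are commuting involutions with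
  \<open>t S t = S\<^sup>-\<^sup>1\<close>, \<open>s r s = r\<^sup>-\<^sup>1\<close>, \<open>t r = r t\<close>, and \<open>8z = S(1 + t) + s t + r(1 + s) + 3\<close>. Decompose a
  unitary representation into the joint eigenspaces of \<open>(s, t)\<close>. The summand \<open>S(1 + t)\<close> acts as \<open>2S\<close>
  on \<open>(+,+)\<close>, where \<open>S\<close> is a self-adjoint involution, maps \<open>(-,+)\<close> to \<open>(-,-)\<close>, and kills the rest;
  \<open>r(1 + s)\<close> acts on \<open>(+,\<plusminus>)\<close> as \<open>r + r\<^sup>-\<^sup>1\<close>, which stays there, plus \<open>r - r\<^sup>-\<^sup>1\<close>, which leads to
  \<open>(-,\<plusminus>)\<close>, and kills the rest. So \<open>8z\<close> is block triangular for
  \<open>(+,+) \<rightarrow> (-,+) \<rightarrow> (-,-) \<leftarrow> (+,-)\<close> with self-adjoint diagonal blocks. Rescaling the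
  blocks makes the off-diagonal part, hence the imaginary part of the numerical range, arbitrarily
  small, so that \<open>c - z\<close> is coercive up to a scalar factor for each non-real \<open>c\<close>, and a Neumann series
  inverts it.\<close>

section \<open>Semi-inner products and numerical ranges\<close>

text \<open>Positivity is only semidefinite and the axioms hold on a subset \<open>V\<close> of a
  type, so that square-integrable functions themselves, rather than their classes, can serve as
  vectors.\<close>

locale semi_inner_space = vector_space scale
  for scale :: "complex \<Rightarrow> 'v::ab_group_add \<Rightarrow> 'v" +
  fixes V :: "'v set" and ip :: "'v \<Rightarrow> 'v \<Rightarrow> complex"
  assumes V_add: "x \<in> V \<Longrightarrow> y \<in> V \<Longrightarrow> x + y \<in> V"
    and V_scale: "x \<in> V \<Longrightarrow> scale c x \<in> V"
    and ip_add_left: "x \<in> V \<Longrightarrow> y \<in> V \<Longrightarrow> z \<in> V \<Longrightarrow> ip (x + y) z = ip x z + ip y z"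
    and ip_scale_left: "x \<in> V \<Longrightarrow> z \<in> V \<Longrightarrow> ip (scale c x) z = c * ip x z"
    and ip_commute: "x \<in> V \<Longrightarrow> y \<in> V \<Longrightarrow> ip y x = cnj (ip x y)"
    and ip_self_nonneg: "x \<in> V \<Longrightarrow> 0 \<le> Re (ip x x)"
begin

section \<open>The squared seminorm and its inequalities\<close>

definition nsq :: "'v \<Rightarrow> real" where
  "nsq x = Re (ip x x)"

lemma V_minus: "x \<in> V \<Longrightarrow> - x \<in> V"
  using V_scale[of x "-1"] by simp

lemma V_diff: "x \<in> V \<Longrightarrow> y \<in> V \<Longrightarrow> x - y \<in> V"
  using V_add[of x "- y"] V_minus by simp

lemmas V_closed = V_add V_scale V_minus V_diff

lemma ip_add_right: "x \<in> V \<Longrightarrow> y \<in> V \<Longrightarrow> z \<in> V \<Longrightarrow> ip z (x + y) = ip z x + ip z y"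
  by (simp add: ip_commute[of _ z] V_add ip_add_left)

lemma ip_scale_right: "x \<in> V \<Longrightarrow> z \<in> V \<Longrightarrow> ip z (scale c x) = cnj c * ip z x"
  by (simp add: ip_commute[of _ z] V_scale ip_scale_left)

lemma ip_minus_left: "x \<in> V \<Longrightarrow> z \<in> V \<Longrightarrow> ip (- x) z = - ip x z"
  using ip_scale_left[of x z "-1"] by simp

lemma ip_diff_left: "x \<in> V \<Longrightarrow> y \<in> V \<Longrightarrow> z \<in> V \<Longrightarrow> ip (x - y) z = ip x z - ip y z"
  using ip_add_left[of x "- y" z] by (simp add: V_minus ip_minus_left)

lemma ip_self_real: "x \<in> V \<Longrightarrow> Im (ip x x) = 0"
  using ip_commute[of x x] by (simp add: complex_eq_iff)

lemma nsq_nonneg: "x \<in> V \<Longrightarrow> 0 \<le> nsq x"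
  by (simp add: nsq_def ip_self_nonneg)

lemma nsq_scale: "x \<in> V \<Longrightarrow> nsq (scale c x) = (cmod c)\<^sup>2 * nsq x"
  unfolding nsq_def
  by (simp add: V_scale ip_scale_left ip_scale_right ip_self_real cmod_power2
      flip: mult.assoc power2_eq_square)

lemma nsq_add: "x \<in> V \<Longrightarrow> y \<in> V \<Longrightarrow> nsq (x + y) = nsq x + nsq y + 2 * Re (ip x y)"
  unfolding nsq_def
  by (simp add: V_add ip_add_left ip_add_right ip_commute[of y x] algebra_simps)

lemma nsq_minus: "x \<in> V \<Longrightarrow> nsq (- x) = nsq x"
  using nsq_scale[of x "-1"] by simp

lemma nsq_add_le:
  assumes "x \<in> V" "y \<in> V" shows "nsq (x + y) \<le> 2 * nsq x + 2 * nsq y"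
  using nsq_nonneg[of "x + (- y)"] nsq_add[of x y] nsq_add[of x "- y"] nsq_minus[of y] assms
    ip_scale_right[of y x "-1"]
  by (simp add: V_closed)

lemma nsq_diff_le:
  assumes "x \<in> V" "y \<in> V" shows "nsq (x - y) \<le> 2 * nsq x + 2 * nsq y"
  using nsq_add_le[of x "- y"] nsq_minus[of y] assms by (simp add: V_closed)

text \<open>Expanding the squared seminorm of \<open>r x + \<i> s y\<close> with
  \<open>s = 1\<close> or \<open>s = -1\<close> isolates the imaginary part. The free weight
  \<open>r\<close> is what the rescaling of blocks exploits later.\<close>

lemma young_Im_ip:
  assumes "x \<in> V" "y \<in> V" "0 < r"
  shows "2 * \<bar>Im (ip x y)\<bar> \<le> r * nsq x + nsq y / r"
proof -
  have *: "0 \<le> r * nsq x + nsq y / r + 2 * (s * Im (ip x y))" if "s * s = 1" for s :: real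
  proof -
    let ?y = "scale (\<i> * of_real s) y"
    have "0 \<le> nsq (scale (of_real r) x + ?y)"
      by (intro nsq_nonneg V_closed assms)
    also have "\<dots> = r\<^sup>2 * nsq x + s\<^sup>2 * nsq y + 2 * r * (s * Im (ip x y))"
      using assms by (simp add: nsq_add nsq_scale V_closed ip_scale_left ip_scale_right norm_mult)
    also have "\<dots> = r * (r * nsq x + nsq y / r + 2 * (s * Im (ip x y)))"
      using assms that by (simp add: field_simps power2_eq_square)
    finally show ?thesis
      using assms by (simp add: zero_le_mult_iff)
  qed
  from *[of 1] *[of "-1"] show ?thesis by (simp add: abs_le_iff)
qed

text \<open>If the numerical range of \<open>A\<close> lies in the strip \<open>\<bar>Im\<bar> \<le> \<eta>\<close> and \<open>\<bar>Im c\<bar> > \<eta>\<close>, then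
  a suitable multiple of \<open>c - A\<close> has positive real part, hence differs from the identity by a
  contraction.\<close>

lemma numerical_range_resolvent:
  assumes A: "\<And>v. v \<in> V \<Longrightarrow> A v \<in> V"
    and bound: "\<And>v. v \<in> V \<Longrightarrow> nsq (A v) \<le> b * nsq v" "0 \<le> b"
    and strip: "\<And>v. v \<in> V \<Longrightarrow> \<bar>Im (ip (A v) v)\<bar> \<le> \<eta> * nsq v" "\<eta> < \<bar>Im c\<bar>"
  obtains k \<tau> q where "0 < k" "\<tau> \<noteq> 0" "0 < q" "q < 1"
    and "\<And>v. v \<in> V \<Longrightarrow> k * nsq v \<le> nsq (scale c v - A v)"
    and "\<And>v. v \<in> V \<Longrightarrow> nsq (v - scale \<tau> (scale c v - A v)) \<le> q * nsq v"
proof -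
  define k where "k = \<bar>Im c\<bar> - \<eta>"
  \<comment> \<open>\<open>L\<close> bounds \<open>nsq (c v - A v)\<close> relative to
    \<open>nsq v\<close>; the extra \<open>k\<^sup>2 + 1\<close> forces
    \<open>k\<^sup>2 < L\<close>, so that \<open>q = 1 - k\<^sup>2 / L\<close> lies strictly between
    0 and 1. The step size \<open>t = k / L\<close> minimizes
    \<open>1 - 2 t k + t\<^sup>2 L\<close>.\<close>
  define L where "L = 2 * (cmod c)\<^sup>2 + 2 * b + k\<^sup>2 + 1"
  define t where "t = k / L"
  define s where "s = (if 0 \<le> Im c then 1 else -1 :: real)"
  have k: "0 < k" using strip(2) by (simp add: k_def)
  have L: "0 < L" "k\<^sup>2 < L" using bound(2) by (auto simp: L_def intro: add_nonneg_pos)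
  have t: "0 < t" using k L by (simp add: t_def)
  have s: "s * s = 1" "s * Im c = \<bar>Im c\<bar>" "s = 1 \<or> s = -1" by (auto simp: s_def)
  let ?B = "\<lambda>v. scale c v - A v"
  have B: "?B v \<in> V" if "v \<in> V" for v
    using that A by (simp add: V_closed)
  have Im: "k * nsq v \<le> s * Im (ip (?B v) v)" if v: "v \<in> V" for v
  proof -
    have "Im (ip (?B v) v) = Im c * nsq v - Im (ip (A v) v)"
      using v by (simp add: nsq_def ip_diff_left ip_scale_left V_closed A ip_self_real)
    then have "s * Im (ip (?B v) v) = \<bar>Im c\<bar> * nsq v - s * Im (ip (A v) v)"
      by (simp add: right_diff_distrib s(2) flip: mult.assoc)
    moreover have "s * Im (ip (A v) v) \<le> \<eta> * nsq v"
      using strip(1)[OF v] s(3) by auto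
    ultimately show ?thesis
      by (simp add: k_def algebra_simps)
  qed
  have lower: "k\<^sup>2 * nsq v \<le> nsq (?B v)" if v: "v \<in> V" for v
  proof -
    have "2 * (k * nsq v) \<le> 2 * \<bar>Im (ip (?B v) v)\<bar>"
      using Im[OF v] s(3) by auto
    also have "\<dots> \<le> (1 / k) * nsq (?B v) + nsq v / (1 / k)"
      using k v B by (intro young_Im_ip) auto
    finally show ?thesis
      using k by (simp add: field_simps power2_eq_square)
  qed
  have upper: "nsq (?B v) \<le> L * nsq v" if v: "v \<in> V" for v
  proof -
    have "nsq (?B v) \<le> 2 * nsq (scale c v) + 2 * nsq (A v)"
      using v by (intro nsq_diff_le) (simp_all add: V_closed A)
    also have "\<dots> \<le> 2 * ((cmod c)\<^sup>2 * nsq v) + 2 * (b * nsq v)"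
      using v bound(1)[OF v] by (simp add: nsq_scale)
    also have "\<dots> \<le> L * nsq v"
      using nsq_nonneg[OF v] by (simp add: L_def algebra_simps)
    finally show ?thesis .
  qed
  \<comment> \<open>The factor \<open>- \<i> s\<close> turns the lower bound on the signed imaginary
    part of the form of \<open>c - A\<close> into one on a real part.\<close>
  define \<tau> where "\<tau> = - \<i> * of_real (s * t)"
  have \<tau>: "\<tau> \<noteq> 0" "cmod \<tau> = t"
    using s(3) t by (auto simp: \<tau>_def norm_mult)
  have contr: "nsq (v - scale \<tau> (?B v)) \<le> (1 - k\<^sup>2 / L) * nsq v" if v: "v \<in> V" for v
  proof -
    have "nsq (v - scale \<tau> (?B v)) = nsq (v + scale (- \<tau>) (?B v))"
      by simp
    also have "\<dots> = nsq v + t\<^sup>2 * nsq (?B v) + 2 * Re (ip v (scale (- \<tau>) (?B v)))"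
      using v B by (subst nsq_add) (simp_all add: V_closed nsq_scale \<tau> del: scale_minus_left)
    also have "Re (ip v (scale (- \<tau>) (?B v))) = - t * (s * Im (ip (?B v) v))"
      using v B[OF v] by (simp add: ip_scale_right ip_commute[of "?B v" v] \<tau>_def del: scale_minus_left)
    also have "nsq v + t\<^sup>2 * nsq (?B v) + 2 * (- t * (s * Im (ip (?B v) v)))
        \<le> nsq v + t\<^sup>2 * (L * nsq v) + 2 * (- t * (k * nsq v))"
      using mult_left_mono[OF upper[OF v] zero_le_power2[of t]]
        mult_left_mono[OF Im[OF v] less_imp_le[OF t]] by linarith
    also have "\<dots> = (1 - k\<^sup>2 / L) * nsq v"
      using L by (simp add: t_def field_simps power2_eq_square)
    finally show ?thesis .
  qed
  show thesis
    by (rule that[of "k\<^sup>2" \<tau> "1 - k\<^sup>2 / L"]) (use k L \<tau> lower contr in \<open>auto simp: field_simps\<close>)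
qed

end

section \<open>The quaquaversal operator in a unitary representation\<close>

text \<open>\<open>S\<close>, \<open>t\<close>, \<open>r\<close> stand for the actions of \<open>S\<close>, \<open>T\<^sup>3\<close>, \<open>T\<^sup>4\<close>, and \<open>N\<close> for that of \<open>8z\<close>.\<close>

locale quaquaversal_rep = semi_inner_space scale V ip
  for scale :: "complex \<Rightarrow> 'v::ab_group_add \<Rightarrow> 'v" and V and ip :: "'v \<Rightarrow> 'v \<Rightarrow> complex" +
  fixes S t r :: "'v \<Rightarrow> 'v"
  assumes add [simp]: "S (x + y) = S x + S y" "t (x + y) = t x + t y" "r (x + y) = r x + r y"
    and scale [simp]: "S (scale c x) = scale c (S x)" "t (scale c x) = scale c (t x)"
      "r (scale c x) = scale c (r x)"
    and closed [simp]: "x \<in> V \<Longrightarrow> S x \<in> V" "x \<in> V \<Longrightarrow> t x \<in> V" "x \<in> V \<Longrightarrow> r x \<in> V"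
    and isometry: "x \<in> V \<Longrightarrow> y \<in> V \<Longrightarrow> ip (S x) (S y) = ip x y"
      "x \<in> V \<Longrightarrow> y \<in> V \<Longrightarrow> ip (t x) (t y) = ip x y"
      "x \<in> V \<Longrightarrow> y \<in> V \<Longrightarrow> ip (r x) (r y) = ip x y"
    and rel: "S (S (S (S x))) = x" "t (t x) = x" "r (r (r x)) = x"
      "t (S x) = S (S (S (t x)))" "t (r x) = r (t x)" "S (S (r x)) = r (r (S (S x)))"
begin

definition N :: "'v \<Rightarrow> 'v" where
  "N v = S v + S (t v) + S (S (t v)) + r v + r (S (S v)) + scale 3 v"

lemma diff [simp]: "S (x - y) = S x - S y" "t (x - y) = t x - t y" "r (x - y) = r x - r y"
  using add(1)[of "x - y" y] add(2)[of "x - y" y] add(3)[of "x - y" y]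
  by (simp_all add: algebra_simps)

text \<open>Four times the component of \<open>v\<close> on which \<open>S\<^sup>2\<close> and \<open>t\<close> (in this order) act by the signs in the
  name: \<open>p\<close> for \<open>+1\<close>, \<open>m\<close> for \<open>-1\<close>.\<close>

definition w_pp :: "'v \<Rightarrow> 'v" where "w_pp v = v + S (S v) + t v + S (S (t v))"
definition w_pm :: "'v \<Rightarrow> 'v" where "w_pm v = v + S (S v) - t v - S (S (t v))"
definition w_mp :: "'v \<Rightarrow> 'v" where "w_mp v = v - S (S v) + t v - S (S (t v))"
definition w_mm :: "'v \<Rightarrow> 'v" where "w_mm v = v - S (S v) - t v + S (S (t v))"

lemmas w_defs = w_pp_def w_pm_def w_mp_def w_mm_def

lemma scale3: "scale 3 v = v + v + v"
proof -
  have "scale (1 + 1 + 1) v = v + v + v" by (simp only: scale_left_distrib scale_one)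
  then show ?thesis by simp
qed

text \<open>This and the next three identities are the rows of the block matrix of \<open>N\<close>.
  The sign of \<open>S\<^sup>2 t\<close> is added to 3, giving 4 or 2; on the blocks where
  \<open>S\<^sup>2\<close> is 1, \<open>r(1 + S\<^sup>2) = 2r\<close> splits into
  \<open>r + r\<^sup>2\<close> within the block and \<open>r - r\<^sup>2\<close> across, where
  \<open>r\<^sup>2\<close> is the inverse of \<open>r\<close>. As rewrite rules, \<open>rel\<close>
  moves \<open>t\<close> inward and \<open>S\<^sup>2\<close> past \<open>r\<close>.\<close>

lemma w_pp_N: "w_pp (N v) = S (w_pp v) + S (w_pp v) + (r (w_pp v) + r (r (w_pp v))) + scale 4 (w_pp v)"
proof -
  have 4: "scale 4 x = x + x + x + x" for x
    using scale_left_distrib[of 3 1 x] by (simp add: scale3)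
  show ?thesis by (simp add: w_defs N_def scale3 4 rel algebra_simps)
qed

lemma w_pm_N: "w_pm (N v) = (r (w_pm v) + r (r (w_pm v))) + scale 2 (w_pm v)"
proof -
  have 2: "scale 2 x = x + x" for x
    using scale_left_distrib[of 1 1 x] by simp
  show ?thesis by (simp add: w_defs N_def scale3 2 rel algebra_simps)
qed

lemma w_mp_N: "w_mp (N v) = (r (w_pp v) - r (r (w_pp v))) + scale 2 (w_mp v)"
proof -
  have 2: "scale 2 x = x + x" for x
    using scale_left_distrib[of 1 1 x] by simp
  show ?thesis by (simp add: w_defs N_def scale3 2 rel algebra_simps)
qed

lemma w_mm_N: "w_mm (N v) = scale 2 (S (w_mp v)) + (r (w_pm v) - r (r (w_pm v))) + scale 4 (w_mm v)"
proof -
  have 2: "scale 2 x = x + x" for x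
    using scale_left_distrib[of 1 1 x] by simp
  have 4: "scale 4 x = x + x + x + x" for x
    using scale_left_distrib[of 3 1 x] by (simp add: scale3)
  show ?thesis by (simp add: w_defs N_def scale3 2 4 rel algebra_simps)
qed

section \<open>Self-adjoint diagonal blocks\<close>

lemma w_closed [simp]:
  "v \<in> V \<Longrightarrow> w_pp v \<in> V" "v \<in> V \<Longrightarrow> w_pm v \<in> V" "v \<in> V \<Longrightarrow> w_mp v \<in> V" "v \<in> V \<Longrightarrow> w_mm v \<in> V"
  by (simp_all add: w_defs V_closed)

lemma nsq_isometry [simp]:
  "x \<in> V \<Longrightarrow> nsq (S x) = nsq x" "x \<in> V \<Longrightarrow> nsq (t x) = nsq x" "x \<in> V \<Longrightarrow> nsq (r x) = nsq x"
  by (simp_all add: nsq_def isometry)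

lemma nsq_r_diff_le: "x \<in> V \<Longrightarrow> nsq (r x - r (r x)) \<le> 4 * nsq x"
  using nsq_diff_le[of "r x" "r (r x)"] by simp

text \<open>\<open>S\<^sup>2\<close> fixes \<open>w_pp v\<close>, so there the isometry
  \<open>S\<close> is its own adjoint.\<close>

lemma Im_ip_S_w_pp: "v \<in> V \<Longrightarrow> Im (ip (S (w_pp v)) (w_pp v)) = 0"
proof -
  assume v: "v \<in> V"
  have "S (S (w_pp v)) = w_pp v"
    by (simp add: w_pp_def rel algebra_simps)
  then have "ip (w_pp v) (S (w_pp v)) = ip (S (w_pp v)) (w_pp v)"
    using isometry(1)[of "S (w_pp v)" "w_pp v"] v by simp
  then show ?thesis
    using ip_commute[of "S (w_pp v)" "w_pp v"] v by (simp add: complex_eq_iff)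
qed

text \<open>Since \<open>r\<^sup>3 = 1\<close>, the square of the isometry \<open>r\<close> is its
  adjoint, so \<open>r + r\<^sup>2\<close> is self-adjoint.\<close>

lemma Im_ip_r: "x \<in> V \<Longrightarrow> Im (ip (r x + r (r x)) x) = 0"
proof -
  assume x: "x \<in> V"
  have "ip (r (r x)) x = ip (r (r x)) (r (r (r x)))"
    by (simp add: rel)
  also have "\<dots> = cnj (ip (r x) x)"
    using x by (simp add: isometry ip_commute[of "r x"])
  finally show ?thesis
    using x by (simp add: ip_add_left)
qed

text \<open>The self-adjoint diagonal blocks contribute nothing; only the three arrows into
  \<open>(-,+)\<close> and \<open>(-,-)\<close> remain.\<close>

lemma Im_w_N:
  assumes "v \<in> V"
  shows "Im (ip (w_pp (N v)) (w_pp v)) = 0" "Im (ip (w_pm (N v)) (w_pm v)) = 0"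
    "Im (ip (w_mp (N v)) (w_mp v)) = Im (ip (r (w_pp v) - r (r (w_pp v))) (w_mp v))"
    "Im (ip (w_mm (N v)) (w_mm v)) = Im (ip (scale 2 (S (w_mp v))) (w_mm v))
      + Im (ip (r (w_pm v) - r (r (w_pm v))) (w_mm v))"
proof -
  show "Im (ip (w_pp (N v)) (w_pp v)) = 0"
    unfolding w_pp_N using assms Im_ip_S_w_pp[of v] Im_ip_r[of "w_pp v"]
    by (simp add: ip_add_left[of _ _ "w_pp v"] V_closed ip_scale_left ip_self_real)
  show "Im (ip (w_pm (N v)) (w_pm v)) = 0"
    unfolding w_pm_N using assms Im_ip_r[of "w_pm v"]
    by (simp add: ip_add_left[of _ _ "w_pm v"] V_closed ip_scale_left ip_self_real)
  show "Im (ip (w_mp (N v)) (w_mp v)) = Im (ip (r (w_pp v) - r (r (w_pp v))) (w_mp v))"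
    unfolding w_mp_N using assms
    by (simp add: ip_add_left[of _ _ "w_mp v"] V_closed ip_scale_left ip_self_real)
  show "Im (ip (w_mm (N v)) (w_mm v)) = Im (ip (scale 2 (S (w_mp v))) (w_mm v))
      + Im (ip (r (w_pm v) - r (r (w_pm v))) (w_mm v))"
    unfolding w_mm_N using assms
    by (simp add: ip_add_left[of _ _ "w_mm v"] V_closed ip_scale_left ip_self_real)
qed

text \<open>In the sign decomposition \<open>N\<close> is block triangular with self-adjoint diagonal blocks; the
  weights make the off-diagonal blocks small.\<close>

definition wip :: "real \<Rightarrow> 'v \<Rightarrow> 'v \<Rightarrow> complex" where
  "wip d x y = ip (w_pp x) (w_pp y) + ip (w_pm x) (w_pm y) + of_real (d^2) * ip (w_mp x) (w_mp y)
     + of_real (d^4) * ip (w_mm x) (w_mm y)"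

section \<open>The weighted semi-inner product and its equivalence with \<open>ip\<close>\<close>

lemma w_linear:
  "w_pp (x + y) = w_pp x + w_pp y" "w_pm (x + y) = w_pm x + w_pm y"
  "w_mp (x + y) = w_mp x + w_mp y" "w_mm (x + y) = w_mm x + w_mm y"
  "w_pp (scale c x) = scale c (w_pp x)" "w_pm (scale c x) = scale c (w_pm x)"
  "w_mp (scale c x) = scale c (w_mp x)" "w_mm (scale c x) = scale c (w_mm x)"
  by (simp_all add: w_defs algebra_simps)

lemma semi_inner_space_wip: "semi_inner_space scale V (wip d)"
proof unfold_locales
  show "wip d y x = cnj (wip d x y)" if "x \<in> V" "y \<in> V" for x y
    using that by (simp add: wip_def ip_commute[of "w_pp x" "w_pp y"] ip_commute[of "w_pm x" "w_pm y"]
        ip_commute[of "w_mp x" "w_mp y"] ip_commute[of "w_mm x" "w_mm y"])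
qed (simp_all add: V_closed wip_def w_linear ip_add_left ip_scale_left ip_self_nonneg algebra_simps)

lemma nsq_wip: 
  "semi_inner_space.nsq (wip d) x = nsq (w_pp x) + nsq (w_pm x) + d^2 * nsq (w_mp x) + d^4 * nsq (w_mm x)"
  unfolding semi_inner_space.nsq_def[OF semi_inner_space_wip] nsq_def
  by (simp add: wip_def)

text \<open>The parallelogram law, for \<open>t\<close> on each half and then for
  \<open>S\<^sup>2\<close>. The 16 is the square of the 4 by which the \<open>w\<close> vectors
  overstate the components of \<open>v\<close>.\<close>

lemma sum_nsq_w:
  assumes "v \<in> V"
  shows "nsq (w_pp v) + nsq (w_pm v) + nsq (w_mp v) + nsq (w_mm v) = 16 * nsq v"
proof -
  have par: "nsq (x + y) + nsq (x - y) = 2 * nsq x + 2 * nsq y" if "x \<in> V" "y \<in> V" for x y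
    using that nsq_add[of x y] nsq_add[of x "- y"] ip_scale_right[of y x "-1"]
    by (simp add: V_closed nsq_minus)
  have w: "w_pp v = (v + S (S v)) + t (v + S (S v))" "w_pm v = (v + S (S v)) - t (v + S (S v))"
    "w_mp v = (v - S (S v)) + t (v - S (S v))" "w_mm v = (v - S (S v)) - t (v - S (S v))"
    by (simp_all add: w_defs rel)
  show ?thesis
    unfolding w using par[of "v + S (S v)" "t (v + S (S v))"] par[of "v - S (S v)" "t (v - S (S v))"]
      par[of v "S (S v)"] assms
    by (simp add: V_closed del: add diff)
qed

text \<open>Equivalence of the two seminorms, which carries estimates from \<open>wip d\<close> back
  to \<open>ip\<close>.\<close>

lemma nsq_wip_bounds:
  assumes "v \<in> V" "0 < d" "d \<le> 1"
  shows "semi_inner_space.nsq (wip d) v \<le> 16 * nsq v"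
    and "16 * d^4 * nsq v \<le> semi_inner_space.nsq (wip d) v"
proof -
  have d: "d^4 \<le> d^2" "d^2 \<le> 1" "0 \<le> d^4"
    using assms by (auto intro: power_decreasing power_le_one)
  note n = nsq_nonneg[OF w_closed(1)[OF assms(1)]] nsq_nonneg[OF w_closed(2)[OF assms(1)]]
    nsq_nonneg[OF w_closed(3)[OF assms(1)]] nsq_nonneg[OF w_closed(4)[OF assms(1)]]
  have "nsq (w_pp v) + nsq (w_pm v) + d^2 * nsq (w_mp v) + d^4 * nsq (w_mm v)
      \<le> nsq (w_pp v) + nsq (w_pm v) + 1 * nsq (w_mp v) + 1 * nsq (w_mm v)"
    using d n by (intro add_mono mult_right_mono) auto
  then show "semi_inner_space.nsq (wip d) v \<le> 16 * nsq v"
    using sum_nsq_w[OF assms(1)] by (simp add: nsq_wip)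
  have "d^4 * nsq (w_pp v) + d^4 * nsq (w_pm v) + d^4 * nsq (w_mp v) + d^4 * nsq (w_mm v)
      \<le> 1 * nsq (w_pp v) + 1 * nsq (w_pm v) + d^2 * nsq (w_mp v) + d^4 * nsq (w_mm v)"
    using d n by (intro add_mono mult_right_mono) auto
  moreover have "16 * d^4 * nsq v = d^4 * (nsq (w_pp v) + nsq (w_pm v) + nsq (w_mp v) + nsq (w_mm v))"
    using sum_nsq_w[OF assms(1)] by simp
  ultimately show "16 * d^4 * nsq v \<le> semi_inner_space.nsq (wip d) v"
    by (simp add: nsq_wip algebra_simps)
qed

section \<open>Bounds for \<open>N\<close> and its resolvent\<close>

lemma N_closed: "v \<in> V \<Longrightarrow> N v \<in> V"
  by (simp add: N_def V_closed)

text \<open>Each added isometric term takes a constant \<open>b\<close> to \<open>2 b + 2\<close>,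
  giving 4, 10, 22, 46; the last term has squared seminorm \<open>9 nsq v\<close>, whence
  \<open>2 * 46 + 2 * 9 = 110\<close>.\<close>

lemma nsq_N_le:
  assumes "v \<in> V" shows "nsq (N v) \<le> 110 * nsq v"
proof -
  note a = nsq_add_le
  have 1: "nsq (S v + S (t v)) \<le> 4 * nsq v"
    using assms a[of "S v" "S (t v)"] by simp
  have 2: "nsq (S v + S (t v) + S (S (t v))) \<le> 10 * nsq v"
    using assms 1 a[of "S v + S (t v)" "S (S (t v))"] by (simp add: V_closed)
  have 3: "nsq (S v + S (t v) + S (S (t v)) + r v) \<le> 22 * nsq v"
    using assms 2 a[of "S v + S (t v) + S (S (t v))" "r v"] by (simp add: V_closed)
  have 4: "nsq (S v + S (t v) + S (S (t v)) + r v + r (S (S v))) \<le> 46 * nsq v"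
    using assms 3 a[of "S v + S (t v) + S (S (t v)) + r v" "r (S (S v))"] by (simp add: V_closed)
  show ?thesis
    using assms 4 a[of "S v + S (t v) + S (S (t v)) + r v + r (S (S v))" "scale 3 v"]
    by (simp add: V_closed N_def nsq_scale)
qed

text \<open>Along every arrow the weight is multiplied by \<open>d^2\<close> or \<open>d^4\<close>.
  Hence \<open>young_Im_ip\<close> with parameter \<open>1/d\<close> leaves, relative to the
  weights, at least one factor \<open>d\<close> on both terms of its bound.\<close>

lemma Im_wip_N_le:
  assumes v: "v \<in> V" and d: "0 < d" "d \<le> 1"
  shows "\<bar>Im (wip d (N v) v)\<bar> \<le> 3 * d * semi_inner_space.nsq (wip d) v"
proof -
  define n1 n2 n3 n4 where n: "n1 = nsq (w_pp v)" "n2 = nsq (w_pm v)" "n3 = nsq (w_mp v)" "n4 = nsq (w_mm v)"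
  have nn: "0 \<le> n1" "0 \<le> n2" "0 \<le> n3" "0 \<le> n4"
    unfolding n using v by (auto intro: nsq_nonneg)
  define i1 i2 i3 where i: "i1 = Im (ip (r (w_pp v) - r (r (w_pp v))) (w_mp v))"
    "i2 = Im (ip (scale 2 (S (w_mp v))) (w_mm v))" "i3 = Im (ip (r (w_pm v) - r (r (w_pm v))) (w_mm v))"
  have 1: "2 * \<bar>i1\<bar> \<le> 1/d * (4 * n1) + d * n3"
  proof -
    have "2 * \<bar>i1\<bar> \<le> 1/d * nsq (r (w_pp v) - r (r (w_pp v))) + nsq (w_mp v) / (1/d)"
      unfolding i using v d by (intro young_Im_ip) (auto simp: V_closed)
    also have "\<dots> \<le> 1/d * (4 * n1) + nsq (w_mp v) / (1/d)"
      unfolding n using v d by (intro add_right_mono mult_left_mono nsq_r_diff_le) auto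
    finally show ?thesis by (simp add: n mult.commute)
  qed
  have 2: "2 * \<bar>i2\<bar> \<le> 1/d * (4 * n3) + d * n4"
  proof -
    have "2 * \<bar>i2\<bar> \<le> 1/d * nsq (scale 2 (S (w_mp v))) + nsq (w_mm v) / (1/d)"
      unfolding i using v d by (intro young_Im_ip) (auto simp: V_closed)
    then show ?thesis using v by (simp add: n nsq_scale mult.commute)
  qed
  have 3: "2 * \<bar>i3\<bar> \<le> 1/d * (4 * n2) + d * n4"
  proof -
    have "2 * \<bar>i3\<bar> \<le> 1/d * nsq (r (w_pm v) - r (r (w_pm v))) + nsq (w_mm v) / (1/d)"
      unfolding i using v d by (intro young_Im_ip) (auto simp: V_closed)
    also have "\<dots> \<le> 1/d * (4 * n2) + nsq (w_mm v) / (1/d)"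
      unfolding n using v d by (intro add_right_mono mult_left_mono nsq_r_diff_le) auto
    finally show ?thesis by (simp add: n mult.commute)
  qed
  have "\<bar>d^2 * i1 + d^4 * (i2 + i3)\<bar> \<le> \<bar>d^2 * i1\<bar> + \<bar>d^4 * (i2 + i3)\<bar>"
    by (rule abs_triangle_ineq)
  also have "\<dots> \<le> d^2 * \<bar>i1\<bar> + d^4 * (\<bar>i2\<bar> + \<bar>i3\<bar>)"
    by (simp add: abs_mult mult_left_mono abs_triangle_ineq del: distrib_left)
  finally have "2 * \<bar>Im (wip d (N v) v)\<bar> \<le> d^2 * (2 * \<bar>i1\<bar>) + d^4 * (2 * \<bar>i2\<bar> + 2 * \<bar>i3\<bar>)"
    by (simp add: wip_def Im_w_N[OF v] i distrib_left del: of_real_power)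
  also have "\<dots> \<le> d^2 * (1/d * (4 * n1) + d * n3)
      + d^4 * ((1/d * (4 * n3) + d * n4) + (1/d * (4 * n2) + d * n4))"
    using 1 2 3 by (intro add_mono mult_left_mono) auto
  also have "\<dots> = d * (4 * n1 + d^2 * (4 * n2) + 5 * (d^2 * n3) + 2 * (d^4 * n4))"
    using d by (simp add: field_simps power2_eq_square power4_eq_xxxx)
  \<comment> \<open>Rounding the coefficients up to 6 gives twice the claimed constant 3, matching
    the doubled left-hand side.\<close>
  also have "\<dots> \<le> d * (6 * n1 + 1 * (6 * n2) + 6 * (d^2 * n3) + 6 * (d^4 * n4))"
    using d nn by (intro mult_left_mono add_mono mult_mono) (auto simp: power_le_one)
  finally show ?thesis
    by (simp add: nsq_wip flip: n) (simp add: algebra_simps)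
qed

lemma N_diff: "N (x - y) = N x - N y"
  by (simp add: N_def scale3 algebra_simps)

text \<open>The numerical-range argument is run in \<open>wip d\<close>. A contraction there need
  not be one for \<open>ip\<close>, so the decay is stated for iterates, where changing the seminorm
  costs only the constant \<open>C\<close>.\<close>

lemma quaquaversal_resolvent:
  assumes "c \<notin> \<real>"
  obtains k \<tau> q C where "0 < k" "\<tau> \<noteq> 0" "0 < q" "q < 1"
    and "\<And>v. v \<in> V \<Longrightarrow> k * nsq v \<le> nsq (scale c v - scale (1/8) (N v))"
    and "\<And>v n. v \<in> V \<Longrightarrow> ((\<lambda>v. v - scale \<tau> (scale c v - scale (1/8) (N v))) ^^ n) v \<in> V"
    and "\<And>v n. v \<in> V \<Longrightarrow>
      nsq (((\<lambda>v. v - scale \<tau> (scale c v - scale (1/8) (N v))) ^^ n) v) \<le> C * q ^ n * nsq v"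
proof -
  have "0 < \<bar>Im c\<bar>" using assms by (simp add: complex_is_Real_iff)
  \<comment> \<open>The numerical range of \<open>N\<close> divided by 8 lies in a strip of
    half-width \<open>3/8 * d\<close>, which has to stay below
    \<open>\<bar>Im c\<bar>\<close>.\<close>
  define d where "d = min 1 \<bar>Im c\<bar>"
  have d: "0 < d" "d \<le> 1" "3/8 * d < \<bar>Im c\<bar>"
    using \<open>0 < \<bar>Im c\<bar>\<close> by (auto simp: d_def)
  interpret w: semi_inner_space scale V "wip d" by (rule semi_inner_space_wip)
  note wb = nsq_wip_bounds[OF _ d(1,2)]
  have d4: "0 < 16 * d^4" using d by simp
  let ?A = "\<lambda>v. scale (1/8) (N v)"
  have A: "?A v \<in> V" if "v \<in> V" for v
    using that by (simp add: V_closed N_closed)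
  have bound: "w.nsq (?A v) \<le> (110/4) / (16 * d^4) * w.nsq v" if v: "v \<in> V" for v
  proof -
    have "w.nsq (?A v) \<le> 16 * nsq (?A v)" by (rule wb(1)[OF A[OF v]])
    also have "\<dots> = nsq (N v) / 4"
      using v by (simp add: nsq_scale N_closed power2_eq_square)
    also have "\<dots> \<le> 110/4 * nsq v"
      using nsq_N_le[OF v] by simp
    also have "nsq v \<le> w.nsq v / (16 * d^4)"
      using wb(2)[OF v] d4 by (simp add: pos_le_divide_eq mult.commute)
    finally show ?thesis by simp
  qed
  have strip: "\<bar>Im (wip d (?A v) v)\<bar> \<le> (3/8 * d) * w.nsq v" if v: "v \<in> V" for v
    using Im_wip_N_le[OF v d(1,2)] v by (simp add: w.ip_scale_left N_closed abs_mult)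
  obtain k \<tau> q where kq: "0 < k" "\<tau> \<noteq> 0" "0 < q" "q < 1"
    and low: "\<And>v. v \<in> V \<Longrightarrow> k * w.nsq v \<le> w.nsq (scale c v - ?A v)"
    and con: "\<And>v. v \<in> V \<Longrightarrow> w.nsq (v - scale \<tau> (scale c v - ?A v)) \<le> q * w.nsq v"
  proof (rule w.numerical_range_resolvent[of ?A, OF A bound _ strip d(3)])
    show "0 \<le> (110/4) / (16 * d^4)" using d4 by simp
  qed blast+
  let ?K = "\<lambda>v. v - scale \<tau> (scale c v - ?A v)"
  have K: "(?K ^^ n) v \<in> V" if "v \<in> V" for v n
    using that by (induction n) (simp_all add: V_closed A)
  have Kn: "w.nsq ((?K ^^ n) v) \<le> q ^ n * w.nsq v" if v: "v \<in> V" for v n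
  proof (induction n)
    case (Suc n)
    have "w.nsq ((?K ^^ Suc n) v) \<le> q * w.nsq ((?K ^^ n) v)"
      using con[OF K[OF v]] by simp
    also have "\<dots> \<le> q * (q ^ n * w.nsq v)"
      using Suc kq by (intro mult_left_mono) auto
    finally show ?case by simp
  qed simp
  show thesis
  proof (rule that[of "k * d^4" \<tau> q "1 / d^4"])
    show "k * d^4 * nsq v \<le> nsq (scale c v - ?A v)" if v: "v \<in> V" for v
    proof -
      have "k * (16 * d^4 * nsq v) \<le> k * w.nsq v"
        using kq wb(2)[OF v] by (intro mult_left_mono) auto
      also have "\<dots> \<le> w.nsq (scale c v - ?A v)"
        by (rule low[OF v])
      also have "\<dots> \<le> 16 * nsq (scale c v - ?A v)"
        using v by (intro wb(1)) (simp add: V_closed A)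
      finally show ?thesis by simp
    qed
    show "nsq ((?K ^^ n) v) \<le> 1 / d^4 * q ^ n * nsq v" if v: "v \<in> V" for v n
    proof -
      have "16 * d^4 * nsq ((?K ^^ n) v) \<le> w.nsq ((?K ^^ n) v)"
        by (rule wb(2)[OF K[OF v]])
      also have "\<dots> \<le> q ^ n * w.nsq v" by (rule Kn[OF v])
      also have "\<dots> \<le> q ^ n * (16 * nsq v)"
        using kq wb(1)[OF v] by (intro mult_left_mono) auto
      finally show ?thesis using d by (simp add: field_simps)
    qed
  qed (use kq d K in auto)
qed

end

section \<open>The rotations\<close>

text \<open>For the unit axis \<open>u\<close>, \<open>cross3 u\<close> squares to minus the
  projection onto the plane orthogonal to \<open>u\<close>, so Rodrigues operators multiply by the
  angle addition formulas.\<close>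

lemma rotation_about_add:
  assumes "a \<noteq> 0"
  shows "rotation_about a \<alpha> ** rotation_about a \<beta> = rotation_about a (\<alpha> + \<beta>)"
proof -
  define u where "u = sgn a"
  have u: "u \<bullet> u = 1"
    using assms by (simp add: u_def norm_sgn flip: power2_norm_eq_inner)
  have uu: "cross3 u (cross3 u x) = (u \<bullet> x) *\<^sub>R u - x" for x
    using Lagrange[of u u x] u by simp
  have "rotation_about a \<alpha> *v (rotation_about a \<beta> *v x) = rotation_about a (\<alpha> + \<beta>) *v x" for x
    unfolding rotation_about_works u_def[symmetric] cos_add sin_add
    by (simp add: cross_add_right cross_mult_right inner_add_right dot_cross_self uu u)
      (simp add: algebra_simps scaleR_add_left)
  then show ?thesis
    by (simp add: matrix_eq flip: matrix_vector_mul_assoc)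
qed

lemma rotation_about_2pi: "rotation_about a (2 * pi) = Finite_Cartesian_Product.mat 1"
  by (simp add: matrix_eq rotation_about_works)

text \<open>The half-turn about \<open>b\<close> sends the axis \<open>a\<close> to
  \<open>-a\<close> and, being a rotation, respects the cross product; conjugation by it therefore
  reverses the angle.\<close>

lemma rotation_about_pi_conj:
  fixes a b :: "real^3"
  assumes "a \<noteq> 0" "b \<noteq> 0" "a \<bullet> b = 0"
  shows "rotation_about b pi ** rotation_about a \<theta> = rotation_about a (- \<theta>) ** rotation_about b pi"
proof -
  define h where "h = rotation_about b pi"
  define e where "e = sgn a"
  have h: "h *v x = (2 * (sgn b \<bullet> x)) *\<^sub>R sgn b - x" for x
    by (simp add: h_def rotation_about_works)
  have he: "h *v e = - e"
    using assms by (simp add: h e_def sgn_div_norm inner_commute[of a b])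
  have rot: "rotation_matrix h"
    using rotation_about_in_SO3[OF assms(2), of pi] by (simp add: h_def)
  have cr: "h *v cross3 e x = - cross3 e (h *v x)" for x
    using cross_rotation_matrix[OF rot, of e x] he by simp
  have ip: "e \<bullet> (h *v x) = - (e \<bullet> x)" for x
    using assms by (simp add: h e_def inner_diff_right sgn_div_norm inner_commute[of a b])
  have "h *v (rotation_about a \<theta> *v x) = rotation_about a (- \<theta>) *v (h *v x)" for x
    unfolding rotation_about_works e_def[symmetric]
    by (simp add: matrix_vector_right_distrib matrix_vector_mult_scaleR cr he ip)
  then show ?thesis
    by (simp add: matrix_eq h_def flip: matrix_vector_mul_assoc)
qed

lemma SO3_nat_pow_rotation_about:
  assumes "a \<noteq> 0"
  shows "rotation_about a \<theta> [^]\<^bsub>SO3\<^esub> (n::nat) = rotation_about a (n * \<theta>)"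
proof (induction n)
  case 0
  show ?case by (simp add: matrix_eq rotation_about_works)
next
  case (Suc n)
  then show ?case
    by (simp add: rotation_about_add[OF assms] algebra_simps)
qed

text \<open>\<open>T\<^sup>3\<close> and \<open>S\<^sup>2\<close> are the half-turns about
  \<open>b\<close> and \<open>a\<close>, so both conjugation relations come from
  \<open>rotation_about_pi_conj\<close>, the second with the axes exchanged. Inverses are written as
  positive powers, as in \<open>rel\<close>.\<close>

lemma quaquaversal_generators:
  fixes a b :: "real^3" and S T :: "real^3^3"
  assumes "a \<noteq> 0" "b \<noteq> 0" "a \<bullet> b = 0"
    and S: "S = rotation_about a (pi / 2)" and T: "T = rotation_about b (pi / 3)"
  defines "t \<equiv> T [^]\<^bsub>SO3\<^esub> (3::nat)" and "r \<equiv> T [^]\<^bsub>SO3\<^esub> (4::nat)"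
  shows "S \<in> carrier SO3" "t \<in> carrier SO3" "r \<in> carrier SO3"
    and "S [^]\<^bsub>SO3\<^esub> (2::nat) = S ** S"
    and "S ** (S ** (S ** S)) = Finite_Cartesian_Product.mat 1"
    and "t ** t = Finite_Cartesian_Product.mat 1"
    and "r ** (r ** r) = Finite_Cartesian_Product.mat 1"
    and "t ** S = S ** (S ** (S ** t))"
    and "t ** r = r ** t"
    and "S ** (S ** r) = r ** (r ** (S ** S))"
proof -
  note add = rotation_about_add[OF assms(1)] rotation_about_add[OF assms(2)]
  have t: "t = rotation_about b pi" and r: "r = rotation_about b (4 * pi / 3)"
    by (simp_all add: t_def r_def T SO3_nat_pow_rotation_about[OF assms(2)])
  have SS: "S ** S = rotation_about a pi"
    by (simp add: S add)
  have per: "rotation_about x (\<theta> + 2 * pi) = rotation_about x \<theta>" for x \<theta>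
    by (simp add: matrix_eq rotation_about_works)
  show "S \<in> carrier SO3" "t \<in> carrier SO3" "r \<in> carrier SO3"
    unfolding S t r using assms(1,2) by (simp_all only: rotation_about_in_SO3 not_False_eq_True)
  show "S [^]\<^bsub>SO3\<^esub> (2::nat) = S ** S"
    unfolding SS by (simp add: S SO3_nat_pow_rotation_about[OF assms(1)])
  have "S ** (S ** (S ** S)) = rotation_about a (2 * pi)"
    unfolding S add by (simp add: field_simps)
  then show "S ** (S ** (S ** S)) = Finite_Cartesian_Product.mat 1"
    by (simp only: rotation_about_2pi)
  have "t ** t = rotation_about b (2 * pi)"
    unfolding t add by simp
  then show "t ** t = Finite_Cartesian_Product.mat 1"
    by (simp only: rotation_about_2pi)
  have "r ** (r ** r) = rotation_about b (2 * pi + 2 * pi)"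
    unfolding r add by (simp add: field_simps)
  then show "r ** (r ** r) = Finite_Cartesian_Product.mat 1"
    by (simp only: per rotation_about_2pi)
  have "t ** S = rotation_about a (- (pi / 2)) ** t"
    unfolding t S by (rule rotation_about_pi_conj[OF assms(1-3)])
  also have "rotation_about a (- (pi / 2)) = rotation_about a (- (pi / 2) + 2 * pi)"
    by (simp only: per)
  also have "\<dots> = S ** (S ** S)"
    unfolding S add by (simp add: field_simps)
  finally show "t ** S = S ** (S ** (S ** t))"
    by (simp add: matrix_mul_assoc)
  show "t ** r = r ** t"
    unfolding t r add by (simp add: add.commute)
  have "(S ** S) ** r = rotation_about b (- (4 * pi / 3)) ** (S ** S)"
    unfolding SS r using assms by (intro rotation_about_pi_conj) (simp_all add: inner_commute)
  \<comment> \<open>Two full turns give \<open>8 * pi / 3\<close>, which is twice the angle of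
    \<open>r\<close>.\<close>
  also have "rotation_about b (- (4 * pi / 3)) = rotation_about b ((- (4 * pi / 3) + 2 * pi) + 2 * pi)"
    by (simp only: per)
  also have "\<dots> = r ** r"
    unfolding r add by (simp add: field_simps)
  finally show "S ** (S ** r) = r ** (r ** (S ** S))"
    by (simp add: matrix_mul_assoc)
qed

text \<open>Pairing with \<open>F\<close> is additive on the group ring, so the six terms can be
  evaluated separately even if some of the rotations coincide.\<close>

lemma sum_keys_quaquaversal:
  fixes F :: "real^3^3 \<Rightarrow> complex" and S T :: "real^3^3"
  assumes S2: "S [^]\<^bsub>SO3\<^esub> (2::nat) = S ** S"
  defines "t \<equiv> T [^]\<^bsub>SO3\<^esub> (3::nat)" and "r \<equiv> T [^]\<^bsub>SO3\<^esub> (4::nat)"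
  shows "(\<Sum>g\<in>Poly_Mapping.keys (quaquaversal S T). Poly_Mapping.lookup (quaquaversal S T) g * F g)
    = 1/8 * (F S + F (S ** t) + F (S ** S ** t) + F r + F (r ** (S ** S))
        + 3 * F (Finite_Cartesian_Product.mat 1))"
proof -
  define E where "E p = (\<Sum>g\<in>Poly_Mapping.keys p. Poly_Mapping.lookup p g * F g)"
    for p :: "(real^3^3) \<Rightarrow>\<^sub>0 complex"
  have add: "E (p + q) = E p + E q" for p q
    unfolding E_def by (rule setsum_keys_plus_distrib) (simp_all add: algebra_simps)
  have single: "E (Poly_Mapping.single g x) = x * F g" for g x
    by (simp add: E_def)
  have lookup_map: "Poly_Mapping.lookup (Poly_Mapping.map ((*) (1/8)) p) g = 1/8 * Poly_Mapping.lookup p g"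
    for p :: "(real^3^3) \<Rightarrow>\<^sub>0 complex" and g
    by (simp add: map.rep_eq when_def)
  have "Poly_Mapping.keys (Poly_Mapping.map ((*) (1/8)) p) = Poly_Mapping.keys p"
    for p :: "(real^3^3) \<Rightarrow>\<^sub>0 complex"
    unfolding Poly_Mapping.keys.rep_eq lookup_map by simp
  then have map: "E (Poly_Mapping.map ((*) (1/8)) p) = 1/8 * E p" for p
    by (simp add: E_def lookup_map sum_distrib_left mult.assoc del: times_divide_eq_left)
  show ?thesis
    unfolding E_def[symmetric] quaquaversal_def Let_def map add single S2 t_def[symmetric]
      r_def[symmetric] by simp
qed

lemma rotation_matrix_mult:
  fixes A B :: "real^'n^'n"
  shows
  "rotation_matrix A \<Longrightarrow> rotation_matrix B \<Longrightarrow> rotation_matrix (A ** B)"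
  by (auto simp: rotation_matrix_def Determinants.det_mul intro: orthogonal_matrix_mul)

text \<open>Serves both the matrix and the function-space realization: words in the operators become
  \<open>U\<close> of group products, to which \<open>quaquaversal_generators\<close>
  applies.\<close>

lemma quaquaversal_rep_of_action:
  fixes a b :: "real^3" and S T :: "real^3^3" and sc :: "complex \<Rightarrow> 'v::ab_group_add \<Rightarrow> 'v"
  assumes ab: "a \<noteq> 0" "b \<noteq> 0" "a \<bullet> b = 0"
    and ST: "S = rotation_about a (pi / 2)" "T = rotation_about b (pi / 3)"
    and "semi_inner_space sc V ip"
    and lin: "\<And>g x y. g \<in> carrier SO3 \<Longrightarrow> U g (x + y) = U g x + U g y"
      "\<And>g k x. g \<in> carrier SO3 \<Longrightarrow> U g (sc k x) = sc k (U g x)"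
    and closed: "\<And>g x. g \<in> carrier SO3 \<Longrightarrow> x \<in> V \<Longrightarrow> U g x \<in> V"
    and isom: "\<And>g x y. g \<in> carrier SO3 \<Longrightarrow> x \<in> V \<Longrightarrow> y \<in> V \<Longrightarrow> ip (U g x) (U g y) = ip x y"
    and hom: "\<And>g h x. g \<in> carrier SO3 \<Longrightarrow> h \<in> carrier SO3 \<Longrightarrow> U (g ** h) x = U g (U h x)"
    and one: "\<And>x. U (Finite_Cartesian_Product.mat 1) x = x"
  shows "quaquaversal_rep sc V ip (U S) (U (T [^]\<^bsub>SO3\<^esub> (3::nat))) (U (T [^]\<^bsub>SO3\<^esub> (4::nat)))"
proof -
  interpret semi_inner_space sc V ip by fact
  define t r where "t = T [^]\<^bsub>SO3\<^esub> (3::nat)" and "r = T [^]\<^bsub>SO3\<^esub> (4::nat)"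
  note gens = quaquaversal_generators[OF ab ST, folded t_def r_def]
  have m: "A ** B \<in> carrier SO3" if "A \<in> carrier SO3" "B \<in> carrier SO3" for A B
    using that by (simp add: rotation_matrix_mult)
  have word: "U A (U B x) = U (A ** B) x" if "A \<in> carrier SO3" "B \<in> carrier SO3" for A B x
    using that by (simp only: hom)
  show ?thesis
    unfolding t_def[symmetric] r_def[symmetric]
  proof unfold_locales
    show "U S (U S (U S (U S x))) = x" "U t (U t x) = x" "U r (U r (U r x)) = x"
      "U t (U S x) = U S (U S (U S (U t x)))" "U t (U r x) = U r (U t x)"
      "U S (U S (U r x)) = U r (U r (U S (U S x)))" for x
      by (simp_all only: word m gens one)
  qed (use gens(1-3) lin closed isom in blast)+
qed

section \<open>Finite-dimensional representations\<close>

text \<open>Vectors are modelled as functions on all naturals, a type with a group structure that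
  serves every \<open>n\<close>. Entries from \<open>n\<close> on are left unchanged so that
  \<open>1\<^sub>m n\<close> acts as the identity on every function.\<close>

definition matrix_action :: "nat \<Rightarrow> complex Matrix.mat \<Rightarrow> (nat \<Rightarrow> complex) \<Rightarrow> nat \<Rightarrow> complex" where
  "matrix_action n A f = (\<lambda>i. if i < n then \<Sum>j<n. A $$ (i, j) * f j else f i)"

definition dot :: "nat \<Rightarrow> (nat \<Rightarrow> complex) \<Rightarrow> (nat \<Rightarrow> complex) \<Rightarrow> complex" where
  "dot n f h = (\<Sum>i<n. f i * cnj (h i))"

lemma semi_inner_space_dot: "semi_inner_space (\<lambda>k f i. k * f i) UNIV (dot n)"
proof unfold_locales
  show "0 \<le> Re (dot n x x)" for x
    by (auto simp: dot_def intro!: sum_nonneg add_nonneg_nonneg)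
qed (auto simp: dot_def fun_eq_iff algebra_simps sum.distrib sum_distrib_left)

lemma matrix_action_mult:
  assumes "A \<in> carrier_mat n n" "B \<in> carrier_mat n n"
  shows "matrix_action n (A * B) f = matrix_action n A (matrix_action n B f)"
proof
  fix i
  have "(\<Sum>j<n. (A * B) $$ (i, j) * f j) = (\<Sum>k<n. A $$ (i, k) * (\<Sum>j<n. B $$ (k, j) * f j))"
    if "i < n"
  proof -
    have "(\<Sum>j<n. (A * B) $$ (i, j) * f j) = (\<Sum>j<n. \<Sum>k<n. A $$ (i, k) * B $$ (k, j) * f j)"
      using that assms
      by (intro sum.cong) (auto simp: scalar_prod_def sum_distrib_right lessThan_atLeast0)
    also have "\<dots> = (\<Sum>k<n. \<Sum>j<n. A $$ (i, k) * B $$ (k, j) * f j)"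
      by (rule sum.swap)
    finally show ?thesis
      by (simp add: sum_distrib_left mult.assoc)
  qed
  then show "matrix_action n (A * B) f i = matrix_action n A (matrix_action n B f) i"
    by (simp add: matrix_action_def)
qed

lemma matrix_action_one: "matrix_action n (1\<^sub>m n) f = f"
proof
  fix i
  have "(\<Sum>j<n. 1\<^sub>m n $$ (i, j) * f j) = (\<Sum>j<n. if i = j then f j else 0)" if "i < n"
    using that by (intro sum.cong) auto
  then show "matrix_action n (1\<^sub>m n) f i = f i"
    by (simp add: matrix_action_def)
qed

text \<open>The adjoint condition says that the columns of \<open>A\<close> are orthonormal
  (\<open>col\<close>); the triple sum is reordered so that the row index is summed
  innermost.\<close>

lemma dot_matrix_action:
  assumes A: "A \<in> carrier_mat n n" and adj: "mat_adjoint A * A = 1\<^sub>m n"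
  shows "dot n (matrix_action n A f) (matrix_action n A h) = dot n f h"
proof -
  have col: "(\<Sum>i<n. A $$ (i, j) * cnj (A $$ (i, k))) = (if j = k then 1 else 0)"
    if "j < n" "k < n" for j k
  proof -
    have "(mat_adjoint A * A) $$ (k, j) = (\<Sum>i<n. cnj (A $$ (i, k)) * A $$ (i, j))"
      using that A by (auto simp: scalar_prod_def mat_adjoint_def mat_of_rows_def lessThan_atLeast0
          intro!: sum.cong)
    then show ?thesis
      using that by (auto simp: adj mult.commute)
  qed
  have "dot n (matrix_action n A f) (matrix_action n A h)
      = (\<Sum>i<n. \<Sum>j<n. \<Sum>k<n. (A $$ (i, j) * cnj (A $$ (i, k))) * (f j * cnj (h k)))"
    by (simp add: dot_def matrix_action_def sum_product algebra_simps)
  also have "\<dots> = (\<Sum>j<n. \<Sum>i<n. \<Sum>k<n. (A $$ (i, j) * cnj (A $$ (i, k))) * (f j * cnj (h k)))"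
    by (rule sum.swap)
  also have "\<dots> = (\<Sum>j<n. \<Sum>k<n. \<Sum>i<n. (A $$ (i, j) * cnj (A $$ (i, k))) * (f j * cnj (h k)))"
    by (intro sum.cong sum.swap refl)
  also have "\<dots> = (\<Sum>j<n. \<Sum>k<n. (if j = k then 1 else 0) * (f j * cnj (h k)))"
    by (intro sum.cong refl) (simp add: col flip: sum_distrib_right)
  also have "\<dots> = dot n f h"
    by (simp add: dot_def if_distrib[of "\<lambda>x. x * _"] cong: if_cong)
  finally show ?thesis .
qed

text \<open>The image of the identity is idempotent, and its adjoint cancels one factor.\<close>

lemma unitary_rep_SO3_one:
  assumes "unitary_rep_SO3 n \<rho>"
  shows "\<rho> (Finite_Cartesian_Product.mat 1) = 1\<^sub>m n"
proof -
  let ?I = "Finite_Cartesian_Product.mat 1 :: real^3^3"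
  have I: "?I \<in> carrier SO3"
    using group.is_monoid[OF group_SO3, THEN monoid.one_closed] by (simp only: SO3_simps)
  have c: "\<rho> ?I \<in> carrier_mat n n" and adj: "mat_adjoint (\<rho> ?I) * \<rho> ?I = 1\<^sub>m n"
    using assms I unfolding unitary_rep_SO3_def by blast+
  have "\<rho> (?I \<otimes>\<^bsub>SO3\<^esub> ?I) = \<rho> ?I * \<rho> ?I"
    using assms I unfolding unitary_rep_SO3_def by blast
  then have idem: "\<rho> ?I * \<rho> ?I = \<rho> ?I"
    by simp
  have ca: "mat_adjoint (\<rho> ?I) \<in> carrier_mat n n"
    using c by (auto simp: mat_adjoint_def)
  have "mat_adjoint (\<rho> ?I) * (\<rho> ?I * \<rho> ?I) = 1\<^sub>m n * \<rho> ?I"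
    by (simp only: adj flip: assoc_mult_mat[OF ca c c])
  then show ?thesis
    unfolding idem adj using c by simp
qed

text \<open>An eigenvector for a non-real \<open>c\<close> would be annihilated by
  \<open>c - z\<close>, against the lower bound in \<open>quaquaversal_resolvent\<close>.\<close>

lemma eigenvalue_rep_ext_real:
  fixes a b :: "real^3" and S T :: "real^3^3"
  assumes ab: "a \<noteq> 0" "b \<noteq> 0" "a \<bullet> b = 0"
    and ST: "S = rotation_about a (pi / 2)" "T = rotation_about b (pi / 3)"
    and rep: "unitary_rep_SO3 n \<rho>"
    and ev: "eigenvalue (rep_ext n \<rho> (quaquaversal S T)) c"
  shows "c \<in> \<real>"
proof (rule ccontr)
  assume c: "c \<notin> \<real>"
  define t r where "t = T [^]\<^bsub>SO3\<^esub> (3::nat)" and "r = T [^]\<^bsub>SO3\<^esub> (4::nat)"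
  note gens = quaquaversal_generators[OF ab ST, folded t_def r_def]
  let ?sc = "\<lambda>k f i. k * f i :: complex"
  let ?U = "\<lambda>g. matrix_action n (\<rho> g)"
  have \<rho>: "\<rho> g \<in> carrier_mat n n" "mat_adjoint (\<rho> g) * \<rho> g = 1\<^sub>m n" if "g \<in> carrier SO3" for g
    using rep that unfolding unitary_rep_SO3_def by blast+
  have mult: "\<rho> (g ** h) = \<rho> g * \<rho> h" if "g \<in> carrier SO3" "h \<in> carrier SO3" for g h
  proof -
    have "\<rho> (g \<otimes>\<^bsub>SO3\<^esub> h) = \<rho> g * \<rho> h"
      using rep that unfolding unitary_rep_SO3_def by blast
    then show ?thesis by simp
  qed
  have hom: "?U (g ** h) f = ?U g (?U h f)" if "g \<in> carrier SO3" "h \<in> carrier SO3" for g h f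
    by (simp only: mult[OF that] matrix_action_mult[OF \<rho>(1)[OF that(1)] \<rho>(1)[OF that(2)]])
  have one: "?U (Finite_Cartesian_Product.mat 1) f = f" for f
    by (simp only: unitary_rep_SO3_one[OF rep] matrix_action_one)
  interpret quaquaversal_rep ?sc UNIV "dot n" "?U S" "?U t" "?U r"
    unfolding t_def r_def
    by (rule quaquaversal_rep_of_action[OF ab ST semi_inner_space_dot _ _ _ dot_matrix_action[OF \<rho>] hom one])
      (auto simp: matrix_action_def fun_eq_iff algebra_simps sum.distrib sum_distrib_left)
  obtain k where k: "0 < k" "\<And>f. k * nsq f \<le> nsq (?sc c f - ?sc (1/8) (N f))"
    by (rule quaquaversal_resolvent[OF c]) blast
  let ?A = "rep_ext n \<rho> (quaquaversal S T)"
  obtain v where v: "v \<in> carrier_vec n" "v \<noteq> 0\<^sub>v n" "?A *\<^sub>v v = c \<cdot>\<^sub>v v"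
    using ev by (auto simp: eigenvalue_def eigenvector_def rep_ext_def)
  \<comment> \<open>The padding by 0 is invisible to \<open>nsq\<close>, which sums over indices
    below \<open>n\<close> only.\<close>
  define f where "f i = (if i < n then vec_index v i else 0)" for i
  have nsq: "nsq h = (\<Sum>i<n. (cmod (h i))\<^sup>2)" for h
    by (simp add: nsq_def dot_def cmod_power2 sum.distrib flip: power2_eq_square)
  have "1/8 * N f i = c * f i" if i: "i < n" for i
  proof -
    have "c * f i = vec_index (?A *\<^sub>v v) i"
      using i v by (simp add: f_def)
    also have "\<dots> = (\<Sum>j<n. ?A $$ (i, j) * f j)"
      using i v(1) by (auto simp: scalar_prod_def f_def lessThan_atLeast0 rep_ext_def intro!: sum.cong)
    also have "\<dots> = (\<Sum>j<n. \<Sum>g\<in>Poly_Mapping.keys (quaquaversal S T).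
        Poly_Mapping.lookup (quaquaversal S T) g * (\<rho> g $$ (i, j) * f j))"
      using i by (intro sum.cong) (auto simp: rep_ext_def sum_distrib_right mult.assoc)
    also have "\<dots> = (\<Sum>g\<in>Poly_Mapping.keys (quaquaversal S T).
        Poly_Mapping.lookup (quaquaversal S T) g * ?U g f i)"
      using i by (subst sum.swap) (simp add: matrix_action_def sum_distrib_left)
    also have "\<dots> = 1/8 * N f i"
      unfolding sum_keys_quaquaversal[OF gens(4), of T, folded t_def r_def] N_def
      using gens(1-3) by (simp add: hom one rotation_matrix_mult)
    finally show ?thesis ..
  qed
  then have "nsq (?sc c f - ?sc (1/8) (N f)) = 0"
    by (simp add: nsq)
  with k(2)[of f] k(1) have "nsq f \<le> 0"
    by (simp add: mult_le_0_iff)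
  then have "(cmod (f i))\<^sup>2 = 0" if "i < n" for i
    using that sum_nonneg_eq_0_iff[of "{..<n}" "\<lambda>i. (cmod (f i))\<^sup>2"]
      sum_nonneg[of "{..<n}" "\<lambda>i. (cmod (f i))\<^sup>2"] by (auto simp: nsq)
  then have "v = 0\<^sub>v n"
    using v(1) by (intro eq_vecI) (auto simp: f_def split: if_splits)
  with v(2) show False by contradiction
qed

section \<open>Square-integrable functions\<close>

definition L2_ip :: "'a measure \<Rightarrow> ('a \<Rightarrow> complex) \<Rightarrow> ('a \<Rightarrow> complex) \<Rightarrow> complex" where
  "L2_ip M f h = (\<integral>x. f x * cnj (h x) \<partial>M)"

lemma L2_fun_measurable: "f \<in> L2_fun M \<Longrightarrow> f \<in> borel_measurable M"
  and L2_fun_integrable: "f \<in> L2_fun M \<Longrightarrow> integrable M (\<lambda>x. (cmod (f x))\<^sup>2)"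
  by (simp_all add: L2_fun_def)

lemma L2_fun_scale: "f \<in> L2_fun M \<Longrightarrow> (\<lambda>x. k * f x) \<in> L2_fun M"
  by (auto simp: L2_fun_def norm_mult power_mult_distrib)

lemma L2_fun_add:
  assumes "f \<in> L2_fun M" "h \<in> L2_fun M"
  shows "f + h \<in> L2_fun M"
proof -
  note [measurable] = assms[THEN L2_fun_measurable]
  have "integrable M (\<lambda>x. (cmod (f x + h x))\<^sup>2)"
  proof (rule Bochner_Integration.integrable_bound)
    show "integrable M (\<lambda>x. 2 * (cmod (f x))\<^sup>2 + 2 * (cmod (h x))\<^sup>2)"
      using assms by (auto simp: L2_fun_def)
    have "(cmod (f x + h x))\<^sup>2 \<le> 2 * (cmod (f x))\<^sup>2 + 2 * (cmod (h x))\<^sup>2" for x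
    proof -
      have "(cmod (f x + h x))\<^sup>2 \<le> (cmod (f x) + cmod (h x))\<^sup>2"
        by (intro power_mono norm_triangle_ineq norm_ge_zero)
      also have "\<dots> \<le> 2 * (cmod (f x))\<^sup>2 + 2 * (cmod (h x))\<^sup>2"
        using sum_squares_bound[of "cmod (f x)" "cmod (h x)"] by (simp add: power2_sum)
      finally show ?thesis .
    qed
    then show "AE x in M. norm ((cmod (f x + h x))\<^sup>2)
        \<le> norm (2 * (cmod (f x))\<^sup>2 + 2 * (cmod (h x))\<^sup>2)"
      by simp
  qed simp
  then show ?thesis
    by (simp add: L2_fun_def plus_fun_def)
qed

lemma integrable_L2_ip:
  assumes "f \<in> L2_fun M" "h \<in> L2_fun M"
  shows "integrable M (\<lambda>x. f x * cnj (h x))"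
proof (rule Bochner_Integration.integrable_bound)
  note [measurable] = assms[THEN L2_fun_measurable]
  have "cnj \<in> borel_measurable borel"
    by (intro borel_measurable_continuous_onI continuous_on_cnj continuous_on_id)
  then have "(\<lambda>x. cnj (h x)) \<in> borel_measurable M"
    by (rule measurable_compose_rev) simp
  then show "(\<lambda>x. f x * cnj (h x)) \<in> borel_measurable M" by simp
  show "integrable M (\<lambda>x. (cmod (f x))\<^sup>2 + (cmod (h x))\<^sup>2)"
    using assms by (auto simp: L2_fun_def)
  have "cmod (f x) * cmod (h x) \<le> (cmod (f x))\<^sup>2 + (cmod (h x))\<^sup>2" for x
    using sum_squares_bound[of "cmod (f x)" "cmod (h x)"]
      mult_nonneg_nonneg[OF norm_ge_zero[of "f x"] norm_ge_zero[of "h x"]] by linarith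
  then show "AE x in M. norm (f x * cnj (h x)) \<le> norm ((cmod (f x))\<^sup>2 + (cmod (h x))\<^sup>2)"
    by (simp add: norm_mult)
qed

lemma L2_ip_self: "Re (L2_ip M f f) = (\<integral>x. (cmod (f x))\<^sup>2 \<partial>M)"
proof -
  have "L2_ip M f f = (\<integral>x. complex_of_real ((cmod (f x))\<^sup>2) \<partial>M)"
    unfolding L2_ip_def complex_norm_square ..
  then show ?thesis by (simp only: integral_complex_of_real Re_complex_of_real)
qed

lemma semi_inner_space_L2: "semi_inner_space (\<lambda>k f x. k * f x) (L2_fun M) (L2_ip M)"
proof unfold_locales
  show "L2_ip M (x + y) z = L2_ip M x z + L2_ip M y z"
    if "x \<in> L2_fun M" "y \<in> L2_fun M" "z \<in> L2_fun M" for x y z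
    using that by (simp add: L2_ip_def distrib_right integrable_L2_ip)
  show "L2_ip M y x = cnj (L2_ip M x y)" for x y
    unfolding L2_ip_def
    by (subst Bochner_Integration.integral_cnj[symmetric]) (simp add: mult.commute)
  show "0 \<le> Re (L2_ip M x x)" for x
    by (simp add: L2_ip_self)
qed (auto simp: fun_eq_iff algebra_simps L2_fun_add L2_fun_scale L2_ip_def)

text \<open>Identifies the null vectors of the seminorm with the functions vanishing almost
  everywhere, so that seminorm estimates descend to classes.\<close>

lemma L2_rel_iff:
  assumes "f \<in> L2_fun M" "h \<in> L2_fun M"
  shows "(f, h) \<in> L2_rel M \<longleftrightarrow> (\<integral>x. (cmod (f x - h x))\<^sup>2 \<partial>M) = 0"
proof -
  interpret semi_inner_space "\<lambda>k f x. k * f x" "L2_fun M" "L2_ip M"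
    by (rule semi_inner_space_L2)
  have "integrable M (\<lambda>x. (cmod (f x - h x))\<^sup>2)"
    using L2_fun_integrable[OF V_diff[OF assms]] by simp
  then show ?thesis
    using assms by (simp add: integral_nonneg_eq_0_iff_AE L2_rel_def)
qed

text \<open>The representative picked by \<open>SOME\<close> agrees with \<open>f\<close> almost
  everywhere.\<close>

lemma L2_norm_class:
  assumes "f \<in> L2_fun M"
  shows "L2_norm M (L2_rel M `` {f}) = sqrt (\<integral>x. (cmod (f x))\<^sup>2 \<partial>M)"
proof -
  define h where "h = (SOME h. h \<in> L2_rel M `` {f})"
  have "f \<in> L2_rel M `` {f}"
    using assms by (simp add: L2_rel_def)
  then have "h \<in> L2_rel M `` {f}"
    unfolding h_def by (rule someI[of "\<lambda>h. h \<in> L2_rel M `` {f}"])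
  then have h: "h \<in> borel_measurable M" "AE x in M. f x = h x"
    by (auto simp: L2_rel_def L2_fun_def)
  have "(\<integral>x. (cmod (h x))\<^sup>2 \<partial>M) = (\<integral>x. (cmod (f x))\<^sup>2 \<partial>M)"
    using h assms by (intro integral_cong_AE) (auto simp: L2_fun_def)
  then show ?thesis
    by (simp add: L2_norm_def h_def)
qed

text \<open>With \<open>G = \<Sum> s\<^sup>-\<^sup>n \<bar>h n\<bar>\<^sup>2\<close>, \<open>s = \<surd>q\<close>, the series is dominated by a geometric one:
  \<open>\<bar>h n\<bar> \<le> \<surd>G \<surd>s\<^sup>n\<close>.\<close>

lemma L2_geometric_series:
  fixes h :: "nat \<Rightarrow> 'a \<Rightarrow> complex"
  assumes h: "\<And>n. h n \<in> L2_fun M"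
    and le: "\<And>n. (\<integral>x. (cmod (h n x))\<^sup>2 \<partial>M) \<le> C * q ^ n" and q: "0 < q" "q < 1"
  shows "AE x in M. summable (\<lambda>n. cmod (h n x))"
    and "(\<lambda>x. suminf (\<lambda>n. h n x)) \<in> L2_fun M"
proof -
  \<comment> \<open>Writing \<open>q = s * s\<close> splits the decay: after division by
    \<open>s ^ n\<close> the integrals are still at most \<open>C * s ^ n\<close>, hence summable,
    and \<open>p = sqrt s\<close> becomes the ratio of the pointwise bound.\<close>
  define s where "s = sqrt q"
  define p where "p = sqrt s"
  have s: "0 < s" "s < 1" "s * s = q" using q by (simp_all add: s_def)
  have p: "0 < p" "p < 1" "p * p = s" using s by (simp_all add: p_def)
  define a where "a n x = (cmod (h n x))\<^sup>2 / s ^ n" for n x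
  have [measurable]: "h n \<in> borel_measurable M" for n
    using h by (rule L2_fun_measurable)
  have a_meas [measurable]: "a n \<in> borel_measurable M" for n
    unfolding a_def by simp
  have a_nonneg: "0 \<le> a n x" for n x
    using s by (simp add: a_def)
  have a_int: "integrable M (a n)" for n
    unfolding a_def using L2_fun_integrable[OF h] by simp
  have a_le: "(\<integral>x. a n x \<partial>M) \<le> C * s ^ n" for n
  proof -
    have "(\<integral>x. a n x \<partial>M) = (\<integral>x. (cmod (h n x))\<^sup>2 \<partial>M) / s ^ n"
      by (simp add: a_def)
    also have "\<dots> \<le> C * (s * s) ^ n / s ^ n"
      using le[of n] s by (simp add: divide_right_mono)
    also have "\<dots> = C * s ^ n"
      unfolding power_mult_distrib using s(1) by simp
    finally show ?thesis .
  qed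
  have a_int_nonneg: "0 \<le> (\<integral>x. a n x \<partial>M)" for n
    by (intro Bochner_Integration.integral_nonneg a_nonneg)
  have sum: "summable (\<lambda>n. \<integral>x. a n x \<partial>M)"
  proof (rule summable_comparison_test')
    show "summable (\<lambda>n. C * s ^ n)"
      using s by (intro summable_mult summable_geometric) simp
    show "norm (\<integral>x. a n x \<partial>M) \<le> C * s ^ n" for n
      using a_le[of n] a_int_nonneg[of n] by (simp only: real_norm_def abs_of_nonneg)
  qed
  \<comment> \<open>Sum and integral are exchanged in the extended nonnegative reals; a finite
    integral forces the sum to be finite almost everywhere.\<close>
  have "(\<integral>\<^sup>+x. (suminf (\<lambda>n. ennreal (a n x))) \<partial>M) = (suminf (\<lambda>n. \<integral>\<^sup>+x. ennreal (a n x) \<partial>M))"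
    by (rule nn_integral_suminf) simp
  also have "\<dots> = (suminf (\<lambda>n. ennreal (\<integral>x. a n x \<partial>M)))"
    by (intro suminf_cong nn_integral_eq_integral a_int) (simp add: a_nonneg)
  also have "\<dots> \<noteq> \<infinity>"
    unfolding infinity_ennreal_def by (rule ennreal_suminf_neq_top[OF sum a_int_nonneg])
  finally have "AE x in M. (suminf (\<lambda>n. ennreal (a n x))) \<noteq> \<infinity>"
    by (intro nn_integral_PInf_AE) simp_all
  then have a_sum: "AE x in M. summable (\<lambda>n. a n x)"
    by eventually_elim (auto intro: summable_suminf_not_top a_nonneg)
  define G where "G x = (suminf (\<lambda>n. a n x))" for x
  have G_int: "integrable M G"
    unfolding G_def using a_sum sum a_nonneg
    by (intro integrable_suminf a_int) simp_all
  have dom: "cmod (h n x) \<le> sqrt (G x) * p ^ n" if "summable (\<lambda>n. a n x)" for n x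
  proof -
    have "a n x \<le> G x"
      unfolding G_def using sum_le_suminf[OF that, of "{n}"] a_nonneg by simp
    then have "(cmod (h n x))\<^sup>2 \<le> G x * s ^ n"
      using s by (simp add: a_def field_simps)
    then have "cmod (h n x) \<le> sqrt (G x * s ^ n)"
      by (rule real_le_rsqrt)
    then show ?thesis
      using s by (simp add: real_sqrt_mult real_sqrt_power p_def)
  qed
  have geo: "summable (\<lambda>n. sqrt (G x) * p ^ n)" for x
    using p by (intro summable_mult summable_geometric) simp
  have summ: "summable (\<lambda>n. cmod (h n x))" if "summable (\<lambda>n. a n x)" for x
    by (rule summable_comparison_test'[OF geo[of x], of 0]) (simp add: dom[OF that])
  then show "AE x in M. summable (\<lambda>n. cmod (h n x))"
    using a_sum by (auto elim: eventually_mono)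
  \<comment> \<open>Summing the geometric bound and squaring gives a multiple of the integrable
    \<open>G\<close>.\<close>
  have "integrable M (\<lambda>x. (cmod (suminf (\<lambda>n. h n x)))\<^sup>2)"
  proof (rule Bochner_Integration.integrable_bound)
    show "integrable M (\<lambda>x. G x * (1 / (1 - p))\<^sup>2)"
      using G_int by simp
    show "AE x in M. norm ((cmod (suminf (\<lambda>n. h n x)))\<^sup>2) \<le> norm (G x * (1 / (1 - p))\<^sup>2)"
      using a_sum
    proof eventually_elim
      case (elim x)
      have G0: "0 \<le> G x"
        unfolding G_def using elim a_nonneg by (intro suminf_nonneg)
      have "cmod (suminf (\<lambda>n. h n x)) \<le> (suminf (\<lambda>n. cmod (h n x)))"
        by (rule summable_norm[OF summ[OF elim]])
      also have "\<dots> \<le> (suminf (\<lambda>n. sqrt (G x) * p ^ n))"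
        by (intro suminf_le dom elim summ geo)
      also have "\<dots> = sqrt (G x) * (1 / (1 - p))"
        using p by (simp add: suminf_mult suminf_geometric summable_geometric)
      finally have "(cmod (suminf (\<lambda>n. h n x)))\<^sup>2 \<le> (sqrt (G x) * (1 / (1 - p)))\<^sup>2"
        by (intro power_mono) simp_all
      then show ?case
        using G0 by (simp add: power_mult_distrib power_divide)
    qed
  qed simp
  then show "(\<lambda>x. suminf (\<lambda>n. h n x)) \<in> L2_fun M"
    by (simp add: L2_fun_def)
qed

section \<open>The left regular representation\<close>

text \<open>Change of variables along translation by the inverse of \<open>g\<close>, which
  preserves \<open>M\<close>.\<close>

lemma left_regular_isometry:
  assumes M: "haar_measure_SO3 M" and g: "g \<in> carrier SO3"
    and "f \<in> L2_fun M" "h \<in> L2_fun M"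
  shows "L2_ip M (left_regular g f) (left_regular g h) = L2_ip M f h"
proof -
  let ?t = "\<lambda>x. inv\<^bsub>SO3\<^esub> g \<otimes>\<^bsub>SO3\<^esub> x"
  have i: "inv\<^bsub>SO3\<^esub> g \<in> carrier SO3"
    using g by (rule group.inv_closed[OF group_SO3])
  have d: "distr M M ?t = M"
    using M i unfolding haar_measure_SO3_def by blast
  have "L2_ip M f h = (\<integral>x. f x * cnj (h x) \<partial>distr M M ?t)"
    by (simp only: d L2_ip_def)
  also have "\<dots> = L2_ip M (left_regular g f) (left_regular g h)"
    unfolding L2_ip_def left_regular_def
    by (rule integral_distr[OF left_translation_measurable[OF M i]
        borel_measurable_integrable[OF integrable_L2_ip[OF assms(3,4)]]])
  finally show ?thesis ..
qed

lemma left_regular_mult: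
  assumes "g \<in> carrier SO3" "h \<in> carrier SO3"
  shows "left_regular (g ** h) f = left_regular g (left_regular h f)"
proof -
  have "inv\<^bsub>SO3\<^esub> (g \<otimes>\<^bsub>SO3\<^esub> h) = inv\<^bsub>SO3\<^esub> h \<otimes>\<^bsub>SO3\<^esub> inv\<^bsub>SO3\<^esub> g"
    using assms by (rule group.inv_mult_group[OF group_SO3])
  then show ?thesis
    by (simp add: left_regular_def matrix_mul_assoc)
qed

lemma left_regular_one: "left_regular (Finite_Cartesian_Product.mat 1) f = f"
proof -
  have "inv\<^bsub>SO3\<^esub> \<one>\<^bsub>SO3\<^esub> = \<one>\<^bsub>SO3\<^esub>"
    using group.is_monoid[OF group_SO3] by (rule monoid.inv_one)
  then show ?thesis
    by (simp add: left_regular_def)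
qed

text \<open>Carries convergence of the Neumann series at almost every point to the translated points
  at which the operator evaluates it.\<close>

lemma AE_left_translate:
  assumes M: "haar_measure_SO3 M" and g: "g \<in> carrier SO3" and P: "AE x in M. P x"
  shows "AE x in M. P (inv\<^bsub>SO3\<^esub> g \<otimes>\<^bsub>SO3\<^esub> x)"
proof -
  let ?t = "\<lambda>x. inv\<^bsub>SO3\<^esub> g \<otimes>\<^bsub>SO3\<^esub> x"
  have i: "inv\<^bsub>SO3\<^esub> g \<in> carrier SO3"
    using g by (rule group.inv_closed[OF group_SO3])
  have "distr M M ?t = M"
    using M i unfolding haar_measure_SO3_def by blast
  then have "AE x in distr M M ?t. P x"
    using P by (simp only:)
  from AE_distrD[OF left_translation_measurable[OF M i] this] show ?thesis .
qed

text \<open>For non-real \<open>c\<close> the lower bound gives injectivity on classes and a bounded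
  inverse; surjectivity comes from a Neumann series, summed pointwise almost everywhere instead of
  in norm.\<close>

lemma L2_spectrum_quaquaversal_real:
  fixes a b :: "real^3" and S T :: "real^3^3"
  assumes ab: "a \<noteq> 0" "b \<noteq> 0" "a \<bullet> b = 0"
    and ST: "S = rotation_about a (pi / 2)" "T = rotation_about b (pi / 3)"
    and M: "haar_measure_SO3 M"
  shows "L2_spectrum M (left_regular_ext (quaquaversal S T)) \<subseteq> \<real>"
proof -
  define t r where "t = T [^]\<^bsub>SO3\<^esub> (3::nat)" and "r = T [^]\<^bsub>SO3\<^esub> (4::nat)"
  note gens = quaquaversal_generators[OF ab ST, folded t_def r_def]
  let ?sc = "\<lambda>k f x. k * f x :: complex"
  let ?V = "L2_fun M"
  let ?L = left_regular
  have lin: "?L g (f + h) = ?L g f + ?L g h" "?L g (?sc k f) = ?sc k (?L g f)" for g f h k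
    by (simp_all add: left_regular_def fun_eq_iff)
  interpret quaquaversal_rep ?sc ?V "L2_ip M" "?L S" "?L t" "?L r"
    unfolding t_def r_def
    by (rule quaquaversal_rep_of_action[OF ab ST semi_inner_space_L2 lin left_regular_L2(1)[OF M]
          left_regular_isometry[OF M] left_regular_mult left_regular_one])
  define A where "A = left_regular_ext (quaquaversal S T)"
  have A: "A f = ?sc (1/8) (N f)" for f
  proof
    fix x
    have "A f x = 1/8 * (?L S f x + ?L (S ** t) f x + ?L (S ** S ** t) f x + ?L r f x
        + ?L (r ** (S ** S)) f x + 3 * ?L (Finite_Cartesian_Product.mat 1) f x)"
      unfolding A_def left_regular_ext_def
      by (rule sum_keys_quaquaversal[OF gens(4), of T, folded t_def r_def])
    then show "A f x = ?sc (1/8) (N f) x"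
      using gens(1-3) by (simp add: N_def left_regular_mult left_regular_one rotation_matrix_mult)
  qed
  have nsq: "nsq f = (\<integral>x. (cmod (f x))\<^sup>2 \<partial>M)" for f
    by (simp add: nsq_def L2_ip_self)
  have rel_iff: "(f, h) \<in> L2_rel M \<longleftrightarrow> nsq (f - h) = 0" if "f \<in> ?V" "h \<in> ?V" for f h
    using L2_rel_iff[OF that] by (simp add: nsq)
  have rel_V: "f \<in> ?V" "h \<in> ?V" if "(f, h) \<in> L2_rel M" for f h
    using that by (simp_all add: L2_rel_def)
  have "c \<in> L2_resolvent_set M A" if c: "c \<notin> \<real>" for c
  proof -
    define B where "B = (\<lambda>f x. c * f x - A f x)"
    have B: "B f = ?sc c f - ?sc (1/8) (N f)" for f
      by (simp add: B_def A fun_eq_iff)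
    define lift where "lift = L2_lift M B"
    let ?cl = "\<lambda>f. L2_rel M `` {f}"
    have BV: "B f \<in> ?V" if "f \<in> ?V" for f
      unfolding B by (intro V_closed N_closed that)
    have B_diff: "B (f - h) = B f - B h" for f h
      unfolding B N_diff by (simp add: fun_eq_iff algebra_simps)
    obtain k \<tau> q C where k: "0 < k" "\<And>f. f \<in> ?V \<Longrightarrow> k * nsq f \<le> nsq (B f)"
      and \<tau>: "\<tau> \<noteq> 0" and q: "0 < q" "q < 1"
      and K: "\<And>f n. f \<in> ?V \<Longrightarrow> ((\<lambda>f. f - ?sc \<tau> (B f)) ^^ n) f \<in> ?V"
        "\<And>f n. f \<in> ?V \<Longrightarrow> nsq (((\<lambda>f. f - ?sc \<tau> (B f)) ^^ n) f) \<le> C * q ^ n * nsq f"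
      unfolding B by (rule quaquaversal_resolvent[OF c]) blast
    \<comment> \<open>\<open>B\<close> involves finitely many translates of its argument, and each
      translation respects almost-everywhere equality.\<close>
    have rel_B: "(B f, B h) \<in> L2_rel M" if fh: "(f, h) \<in> L2_rel M" for f h
    proof -
      have L: "(?L g u, ?L g v) \<in> L2_rel M" if "g \<in> carrier SO3" "(u, v) \<in> L2_rel M" for g u v
        by (rule left_regular_L2(2)[OF M that])
      have AE: "AE x in M. u x = v x" if "(u, v) \<in> L2_rel M" for u v
        using that by (simp add: L2_rel_def)
      note S = L[OF gens(1)] and t = L[OF gens(2)] and r = L[OF gens(3)]
      have "AE x in M. B f x = B h x"
        using AE[OF fh] AE[OF S[OF fh]] AE[OF S[OF t[OF fh]]] AE[OF S[OF S[OF t[OF fh]]]]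
          AE[OF r[OF fh]] AE[OF r[OF S[OF S[OF fh]]]]
        by eventually_elim (simp add: B N_def)
      then show ?thesis
        using BV rel_V[OF fh] by (simp add: L2_rel_def)
    qed
    have "congruent (L2_rel M) (\<lambda>f. ?cl (B f))"
      by (rule congruentI) (rule equiv_class_eq[OF equiv_L2_rel rel_B])
    then have lift: "lift (?cl f) = ?cl (B f)" if "f \<in> ?V" for f
      unfolding lift_def L2_lift_def by (rule UN_equiv_class[OF equiv_L2_rel _ that])
    have cl: "?cl f \<in> L2 M" if "f \<in> ?V" for f
      unfolding L2_def using that by (rule quotientI)
    have clE: "\<exists>f\<in>?V. X = ?cl f" if "X \<in> L2 M" for X
      using that unfolding L2_def by (auto elim: quotientE)
    have cl_eq: "?cl f = ?cl h \<longleftrightarrow> (f, h) \<in> L2_rel M" if "f \<in> ?V" "h \<in> ?V" for f h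
      using eq_equiv_class_iff[OF equiv_L2_rel that] .

    \<comment> \<open>Injectivity on classes\<close>
    have inj: "inj_on lift (L2 M)"
    proof (rule inj_onI)
      fix X Y assume X: "X \<in> L2 M" and Y: "Y \<in> L2 M" and eq: "lift X = lift Y"
      obtain f h where f: "f \<in> ?V" "X = ?cl f" and h: "h \<in> ?V" "Y = ?cl h"
        using clE[OF X] clE[OF Y] by blast
      have "nsq (B (f - h)) = 0"
        using eq f h BV by (simp add: lift cl_eq rel_iff B_diff)
      then have "k * nsq (f - h) \<le> 0"
        using k(2)[OF V_diff[OF f(1) h(1)]] by simp
      then have "nsq (f - h) = 0"
        using k(1) nsq_nonneg[OF V_diff[OF f(1) h(1)]] by (simp add: mult_le_0_iff)
      then show "X = Y"
        using f h by (simp add: cl_eq rel_iff)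
    qed

    \<comment> \<open>Surjectivity by a Neumann series\<close>
    have surj: "\<exists>f\<in>?V. (B f, h) \<in> L2_rel M" if h: "h \<in> ?V" for h
    proof -
      let ?K = "\<lambda>f. f - ?sc \<tau> (B f)"
      \<comment> \<open>With \<open>K = 1 - \<tau> B\<close>, the sum \<open>F\<close> of the
        iterates of \<open>K\<close> on \<open>h\<close> satisfies \<open>\<tau> B F = h\<close>
        almost everywhere, so \<open>\<tau> F\<close> is the preimage sought.\<close>
      define u where "u n = (?K ^^ n) h" for n
      define F where "F x = suminf (\<lambda>n. u n x)" for x
      have "(\<integral>x. (cmod (u n x))\<^sup>2 \<partial>M) \<le> (C * nsq h) * q ^ n" for n
        using K(2)[OF h, of n] by (simp add: u_def nsq mult_ac)
      note series = L2_geometric_series[of u, OF _ this q]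
      have uV: "u n \<in> ?V" for n
        unfolding u_def by (rule K(1)[OF h])
      have F: "F \<in> ?V"
        unfolding F_def[abs_def] by (rule series(2)[OF uV])
      have summ: "AE x in M. summable (\<lambda>n. cmod (u n x))"
        by (rule series(1)[OF uV])
      have one: "AE x in M. (\<lambda>n. u n x) sums F x"
        using summ unfolding F_def
        by eventually_elim (auto intro: summable_sums summable_norm_cancel)
      \<comment> \<open>Because \<open>B\<close> combines finitely many translates, it can then be
        applied term by term at almost every point.\<close>
      have sums: "AE x in M. (\<lambda>n. ?L g (u n) x) sums ?L g F x" if "g \<in> carrier SO3" for g
        unfolding left_regular_def by (rule AE_left_translate[OF M that one])
      have word: "S ** t \<in> carrier SO3" "S ** (S ** t) \<in> carrier SO3" "r ** (S ** S) \<in> carrier SO3"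
        using gens(1-3) by (simp_all add: rotation_matrix_mult)
      have N: "N f = (\<lambda>x. ?L S f x + ?L (S ** t) f x + ?L (S ** (S ** t)) f x + ?L r f x
          + ?L (r ** (S ** S)) f x + 3 * f x)" for f
        using gens(1-3) by (simp add: N_def left_regular_mult fun_eq_iff rotation_matrix_mult)
      have "AE x in M. B (?sc \<tau> F) x = h x"
        using one sums[OF gens(1)] sums[OF gens(3)] sums[OF word(1)] sums[OF word(2)] sums[OF word(3)]
      proof eventually_elim
        case (elim x)
        have "(\<lambda>n. B (u n) x) sums B F x"
          unfolding B_def A N by (intro sums_diff sums_mult sums_add elim)
        then have "(\<lambda>n. \<tau> * B (u n) x) sums (\<tau> * B F x)"
          by (rule sums_mult)
        \<comment> \<open>This is the definition of \<open>K\<close>. The series for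
          \<open>\<tau> B F\<close> telescopes to \<open>u 0 = h\<close>, as the terms of the
          convergent series \<open>F\<close> tend to 0.\<close>
        moreover have "\<tau> * B (u n) x = u n x - u (Suc n) x" for n
          by (simp add: u_def)
        ultimately have "(\<lambda>n. u n x - u (Suc n) x) sums (\<tau> * B F x)"
          by simp
        moreover have "(\<lambda>n. u n x - u (Suc n) x) sums (u 0 x - 0)"
          using elim(1) by (intro telescope_sums' summable_LIMSEQ_zero) (rule sums_summable)
        ultimately have "\<tau> * B F x = h x"
          using sums_unique2 by (fastforce simp: u_def)
        moreover have "B (?sc \<tau> F) x = \<tau> * B F x"
          by (simp add: B_def A N left_regular_def algebra_simps)
        ultimately show ?case by simp
      qed
      then show ?thesis
        using F h BV V_scale[OF F] by (intro bexI[of _ "?sc \<tau> F"]) (auto simp: L2_rel_def)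
    qed
    have "lift ` L2 M = L2 M"
    proof
      show "lift ` L2 M \<subseteq> L2 M"
        using clE lift cl BV by fastforce
      show "L2 M \<subseteq> lift ` L2 M"
      proof
        fix X assume "X \<in> L2 M"
        then obtain h where h: "h \<in> ?V" "X = ?cl h" using clE by blast
        obtain f where f: "f \<in> ?V" "(B f, h) \<in> L2_rel M" using surj[OF h(1)] by blast
        have "X = lift (?cl f)"
          using f h BV cl_eq[of "B f" h] by (simp add: lift)
        then show "X \<in> lift ` L2 M" using cl[OF f(1)] by blast
      qed
    qed
    then have "bij_betw lift (L2 M) (L2 M)"
      using inj by (simp add: bij_betw_def)
    \<comment> \<open>The constant \<open>k\<close> compares squared seminorms, hence
      \<open>1 / sqrt k\<close>.\<close>
    moreover have "L2_norm M X \<le> 1 / sqrt k * L2_norm M (lift X)" if X: "X \<in> L2 M" for X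
    proof -
      obtain f where f: "f \<in> ?V" "X = ?cl f" using clE[OF X] by blast
      have "sqrt (k * nsq f) \<le> sqrt (nsq (B f))"
        using k(2)[OF f(1)] by (rule real_sqrt_le_mono)
      then show ?thesis
        unfolding f(2) lift[OF f(1)] L2_norm_class[OF f(1)] L2_norm_class[OF BV[OF f(1)]] nsq
        using k(1) by (simp add: real_sqrt_mult field_simps)
    qed
    ultimately show ?thesis
      unfolding L2_resolvent_set_def Let_def lift_def B_def by blast
  qed
  then show ?thesis
    unfolding L2_spectrum_def A_def by blast
qed

theorem mainTheorem1:
  fixes a b :: "real^3" and S T :: "real^3^3" and z :: "(real^3^3) \<Rightarrow>\<^sub>0 complex"
  assumes "a \<noteq> 0" and "b \<noteq> 0" and "a \<bullet> b = 0"
    and "S = rotation_about a (pi / 2)"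
    and "T = rotation_about b (pi / 3)"
    and "z = quaquaversal S T"
  shows "(\<forall>M. haar_measure_SO3 M \<longrightarrow> L2_spectrum M (left_regular_ext z) \<subseteq> \<real>) \<and>
    (\<forall>k::nat. \<forall>\<rho>. irreducible_unitary_rep_SO3 (2 * k + 1) \<rho> \<longrightarrow>
       (\<forall>c. eigenvalue (rep_ext (2 * k + 1) \<rho> z) c \<longrightarrow> c \<in> \<real>))"
proof (intro conjI allI impI)
  show "L2_spectrum M (left_regular_ext z) \<subseteq> \<real>" if "haar_measure_SO3 M" for M
    unfolding assms(6) using assms(1-5) that by (rule L2_spectrum_quaquaversal_real)
  show "c \<in> \<real>" if "irreducible_unitary_rep_SO3 (2 * k + 1) \<rho>"
    and "eigenvalue (rep_ext (2 * k + 1) \<rho> z) c" for k \<rho> c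
    using assms(1-5) _ that(2)[unfolded assms(6)]
    by (rule eigenvalue_rep_ext_real) (use that(1) in \<open>simp add: irreducible_unitary_rep_SO3_def\<close>)
qed

end
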